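(* Let $S$ be a finite set with $|S|\ge3$ and let $i\ne j$ be elements of $S$. The torus homomorphism $$G_{i,j}:\mathbb G_m^{\binom S2}/\mathbb G_m^S\to\mathbb G_m^{S\setminus\{i,j\}}/\mathbb G_m,\qquad (p_{ab})\mapsto\Bigl(\frac{p_{j\ell}}{p_{i\ell}}\Bigr)_{\ell\in S\setminus\{i,j\}}$$ extends to a toric morphism $Y_{\Sigma(S)}\to\mathbb P^{|S|-3}$, where $\mathbb P^{|S|-3}$ is the projective space with homogeneous coordinates indexed by $S\setminus\{i,j\}$ and dense torus $\mathbb G_m^{S\setminus\{i,j\}}/\mathbb G_m$.
   Context: All varieties are over an algebraically closed field $\mathbf k$ of characteristic zero. $\mathbb G_m^S$ acts on $\mathbb G_m^{\binom S2}$ by $(\lambda_\ell)\cdot(p_{ab})=(\lambda_a\lambda_bp_{ab})$, and $\mathbb G_m^{\binom S2}/\mathbb G_m^S$ is the quotient torus by the image; $p_{ab}=p_{ba}$ as coordinates indexed by unordered pairs. $\mathbb G_m\subset\mathbb G_m^{S\setminus\{i,j\}}$ is the diagonal. $\mathcal M_{0,S}^{\mathrm{trop}}$ is the space of metric trees whose underlying tree is a stable $S$-marked tree (legs labelled by $S$, every vertex of valence at least 3 counting legs), with positive edge lengths and infinite legs; it is a cone complex with one cone $(\mathbb R_{\ge0})^{\mathrm{Edges}(\tau)}$ for each stable tree $\tau$. The map $\Gamma\mapsto-\frac12(d_{ab})_{a,b}$, with $d_{ab}$ the distance between the attaching points of legs $a$ and $b$, embeds $\mathcal M_{0,S}^{\mathrm{trop}}$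 in $\mathbb R^{\binom S2}/\mathbb R^S$ (quotient by the image of $(a_i)\mapsto(a_i+a_j)_{i,j}$), and the images of the cones form a fan $\Sigma(S)$ with respect to the cocharacter lattice of $\mathbb G_m^{\binom S2}/\mathbb G_m^S$; $Y_{\Sigma(S)}$ is its toric variety. *)

theory Defs
  imports "HOL-Analysis.Analysis" "HOL-Algebra.Product_Groups" "HOL-Library.Ramsey"
begin

section \<open>Varieties and their morphisms\<close>

text \<open>
  A variety over an algebraically closed field is given by its closed points, the Zariski topology,
  and the sheaf of regular functions, a sheaf of field-valued functions.  A function on an
  open set \<open>U\<close> is represented by any total function that agrees with it on \<open>U\<close>.
\<close>

record ('p, 'k) variety =
  zariski :: "'p topology"
  regular :: "'p set \<Rightarrow> ('p \<Rightarrow> 'k) \<Rightarrow> bool"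

definition variety_morphism ::
  "('p, 'k, 'x) variety_scheme \<Rightarrow> ('q, 'k, 'y) variety_scheme \<Rightarrow> ('p \<Rightarrow> 'q) \<Rightarrow> bool" where
  "variety_morphism X Y \<phi> \<longleftrightarrow>
     continuous_map (zariski X) (zariski Y) \<phi> \<and>
     (\<forall>V f. openin (zariski Y) V \<longrightarrow> regular Y V f \<longrightarrow>
        regular X {x \<in> topspace (zariski X). \<phi> x \<in> V} (f \<circ> \<phi>))"

text \<open>
  A variety with its dense torus, the latter as an abstract group together with its inclusion.
\<close>

record ('p, 'k, 't) toric_variety = "('p, 'k) variety" +
  torus :: "'t monoid"
  embed :: "'t \<Rightarrow> 'p"

definition toric_morphism ::
  "('p, 'k, 't) toric_variety \<Rightarrow> ('q, 'k, 's) toric_variety \<Rightarrow> ('p \<Rightarrow> 'q) \<Rightarrow> bool" where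
  "toric_morphism X Y \<phi> \<longleftrightarrow>
     variety_morphism X Y \<phi> \<and>
     (\<exists>\<psi> \<in> hom (torus X) (torus Y). \<forall>t \<in> carrier (torus X). \<phi> (embed X t) = embed Y (\<psi> t))"

text \<open>
  \<open>Q\<close> contains the pairs (numerator, denominator) that are allowed as local representations of
  regular functions.
\<close>

definition locally_fraction ::
  "'p topology \<Rightarrow> (('p \<Rightarrow> 'k::field) \<times> ('p \<Rightarrow> 'k)) set \<Rightarrow> 'p set \<Rightarrow> ('p \<Rightarrow> 'k) \<Rightarrow> bool" where
  "locally_fraction X Q U f \<longleftrightarrow>
     (\<forall>x \<in> U. \<exists>W g h. openin X W \<and> x \<in> W \<and> W \<subseteq> U \<and> (g, h) \<in> Q \<and>
        (\<forall>y \<in> W. h y \<noteq> 0 \<and> f y = g y / h y))"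


section \<open>The toric variety of a fan\<close>

text \<open>
  \<open>M\<close> is the character lattice of the torus \<open>T\<close>, \<open>N\<close> the real vector space
  of cocharacters (as an abelian group), \<open>pair\<close> their pairing, \<open>chi m\<close> the
  character given by \<open>m\<close>, and \<open>Sigma\<close> the set of cones.
\<close>

locale fan_data =
  fixes M :: "'m monoid"
    and N :: "'n monoid"
    and pair :: "'m \<Rightarrow> 'n \<Rightarrow> real"
    and T :: "'t monoid"
    and chi :: "'m \<Rightarrow> 't \<Rightarrow> 'k::field"
    and Sigma :: "'n set set"
begin

definition dual_monoid :: "'n set \<Rightarrow> 'm set" where
  "dual_monoid \<sigma> = {m \<in> carrier M. \<forall>u \<in> \<sigma>. 0 \<le> pair m u}"

text \<open>
  The closed points of the spectrum of the monoid algebra of \<open>dual_monoid \<sigma>\<close> are the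
  monoid homomorphisms from \<open>dual_monoid \<sigma>\<close> to the multiplicative monoid of the field.
\<close>

definition chart_points :: "'n set \<Rightarrow> ('m \<Rightarrow> 'k) set" where
  "chart_points \<sigma> = {x \<in> extensional (dual_monoid \<sigma>). x \<one>\<^bsub>M\<^esub> = 1 \<and>
     (\<forall>m \<in> dual_monoid \<sigma>. \<forall>m' \<in> dual_monoid \<sigma>. x (m \<otimes>\<^bsub>M\<^esub> m') = x m * x m')}"

definition chart_ring :: "'n set \<Rightarrow> (('m \<Rightarrow> 'k) \<Rightarrow> 'k) set" where
  "chart_ring \<sigma> = {f. \<exists>A c. finite A \<and> A \<subseteq> dual_monoid \<sigma> \<and> f = (\<lambda>x. \<Sum>m\<in>A. c m * x m)}"

definition chart_zariski :: "'n set \<Rightarrow> ('m \<Rightarrow> 'k) topology" where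
  "chart_zariski \<sigma> =
     topology_generated_by {{x \<in> chart_points \<sigma>. f x \<noteq> 0} |f. f \<in> chart_ring \<sigma>}"

definition chart_regular :: "'n set \<Rightarrow> ('m \<Rightarrow> 'k) set \<Rightarrow> (('m \<Rightarrow> 'k) \<Rightarrow> 'k) \<Rightarrow> bool" where
  "chart_regular \<sigma> = locally_fraction (chart_zariski \<sigma>) (chart_ring \<sigma> \<times> chart_ring \<sigma>)"

text \<open>
  The charts of \<open>\<sigma>\<close> and \<open>\<tau>\<close> are glued along the chart of their common face
  \<open>\<sigma> \<inter> \<tau>\<close>.
\<close>

definition glue :: "(('n set \<times> ('m \<Rightarrow> 'k)) \<times> ('n set \<times> ('m \<Rightarrow> 'k))) set" where
  "glue = {((\<sigma>, x), (\<tau>, y)). \<sigma> \<in> Sigma \<and> \<tau> \<in> Sigma \<and>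
     (\<exists>z \<in> chart_points (\<sigma> \<inter> \<tau>).
        x = restrict z (dual_monoid \<sigma>) \<and> y = restrict z (dual_monoid \<tau>))}"

definition points :: "('n set \<times> ('m \<Rightarrow> 'k)) set set" where
  "points = (SIGMA \<sigma>:Sigma. chart_points \<sigma>) // glue"

definition chart_map :: "'n set \<Rightarrow> ('m \<Rightarrow> 'k) \<Rightarrow> ('n set \<times> ('m \<Rightarrow> 'k)) set" where
  "chart_map \<sigma> x = glue `` {(\<sigma>, x)}"

definition glued_zariski :: "('n set \<times> ('m \<Rightarrow> 'k)) set topology" where
  "glued_zariski = topology (\<lambda>U. U \<subseteq> points \<and>
     (\<forall>\<sigma> \<in> Sigma. openin (chart_zariski \<sigma>) {x \<in> chart_points \<sigma>. chart_map \<sigma> x \<in> U}))"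

definition glued_regular ::
  "('n set \<times> ('m \<Rightarrow> 'k)) set set \<Rightarrow> (('n set \<times> ('m \<Rightarrow> 'k)) set \<Rightarrow> 'k) \<Rightarrow> bool" where
  "glued_regular U f \<longleftrightarrow>
     (\<forall>\<sigma> \<in> Sigma. chart_regular \<sigma> {x \<in> chart_points \<sigma>. chart_map \<sigma> x \<in> U} (f \<circ> chart_map \<sigma>))"

text \<open>
  The torus is the chart of the zero cone \<open>{\<one>\<^bsub>N\<^esub>}\<close>, whose dual monoid is all of
  \<open>M\<close>.
\<close>

definition toric_variety_of_fan :: "(('n set \<times> ('m \<Rightarrow> 'k)) set, 'k, 't) toric_variety" where
  "toric_variety_of_fan =
     \<lparr>zariski = glued_zariski,
      regular = glued_regular,
      torus = T,
      embed = (\<lambda>t. chart_map {\<one>\<^bsub>N\<^esub>} (\<lambda>m\<in>dual_monoid {\<one>\<^bsub>N\<^esub>}. chi m t))\<rparr>"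

lemma openin_glued_zariski:
  "openin glued_zariski U \<longleftrightarrow> U \<subseteq> points \<and>
     (\<forall>\<sigma> \<in> Sigma. openin (chart_zariski \<sigma>) {x \<in> chart_points \<sigma>. chart_map \<sigma> x \<in> U})"
proof -
  have "istopology (\<lambda>U. U \<subseteq> points \<and>
     (\<forall>\<sigma> \<in> Sigma. openin (chart_zariski \<sigma>) {x \<in> chart_points \<sigma>. chart_map \<sigma> x \<in> U}))"
    (is "istopology ?P")
    unfolding istopology_def
  proof (intro conjI allI impI)
    fix U V assume UV: "?P U" "?P V"
    have *: "{x \<in> chart_points \<sigma>. chart_map \<sigma> x \<in> U \<inter> V} =
      {x \<in> chart_points \<sigma>. chart_map \<sigma> x \<in> U} \<inter> {x \<in> chart_points \<sigma>. chart_map \<sigma> x \<in> V}" for \<sigma>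
      by auto
    show "U \<inter> V \<subseteq> points" using UV by auto
    show "\<forall>\<sigma>\<in>Sigma. openin (chart_zariski \<sigma>) {x \<in> chart_points \<sigma>. chart_map \<sigma> x \<in> U \<inter> V}"
      unfolding * using UV by auto
  next
    fix K assume K: "\<forall>U\<in>K. ?P U"
    have *: "{x \<in> chart_points \<sigma>. chart_map \<sigma> x \<in> \<Union>K} =
      (\<Union>U\<in>K. {x \<in> chart_points \<sigma>. chart_map \<sigma> x \<in> U})" for \<sigma>
      by auto
    show "\<Union>K \<subseteq> points" using K by auto
    show "\<forall>\<sigma>\<in>Sigma. openin (chart_zariski \<sigma>) {x \<in> chart_points \<sigma>. chart_map \<sigma> x \<in> \<Union>K}"
      unfolding * using K by auto
  qed
  then show ?thesis
    unfolding glued_zariski_def by (simp add: topology_inverse')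
qed

end


section \<open>Quotient tori\<close>

definition mult_group :: "'k::field monoid" where
  "mult_group = \<lparr>carrier = UNIV - {0}, monoid.mult = (*), one = 1\<rparr>"

definition real_group :: "real monoid" where
  "real_group = \<lparr>carrier = UNIV, monoid.mult = (+), one = 0\<rparr>"

abbreviation torus_power :: "'i set \<Rightarrow> ('i \<Rightarrow> 'k::field) monoid" where
  "torus_power I \<equiv> product_group I (\<lambda>_. mult_group)"

abbreviation real_power :: "'i set \<Rightarrow> ('i \<Rightarrow> real) monoid" where
  "real_power I \<equiv> product_group I (\<lambda>_. real_group)"

definition monomial :: "'i set \<Rightarrow> ('i \<Rightarrow> int) \<Rightarrow> ('i \<Rightarrow> 'k::field) \<Rightarrow> 'k" where
  "monomial I m t = (\<Prod>i\<in>I. t i powi m i)"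

text \<open>
  The characters of \<open>torus_power I Mod H\<close> are the Laurent monomials that are trivial on
  \<open>H\<close>.
\<close>

definition character_lattice :: "'i set \<Rightarrow> ('i \<Rightarrow> 'k::field) set \<Rightarrow> ('i \<Rightarrow> int) monoid" where
  "character_lattice I H = (product_group I (\<lambda>_. integer_group))
     \<lparr>carrier := {m \<in> carrier (product_group I (\<lambda>_. integer_group)). \<forall>t \<in> H. monomial I m t = 1}\<rparr>"

text \<open>
  Functions that are constant on cosets are evaluated on quotients with \<open>the_elem\<close>.
\<close>

definition character :: "'i set \<Rightarrow> ('i \<Rightarrow> int) \<Rightarrow> ('i \<Rightarrow> 'k::field) set \<Rightarrow> 'k" where
  "character I m C = the_elem (monomial I m ` C)"

definition pairing :: "'i set \<Rightarrow> ('i \<Rightarrow> int) \<Rightarrow> ('i \<Rightarrow> real) set \<Rightarrow> real" where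
  "pairing I m C = the_elem ((\<lambda>u. \<Sum>i\<in>I. of_int (m i) * u i) ` C)"


section \<open>Projective space\<close>

definition homogeneous_polys :: "'l set \<Rightarrow> nat \<Rightarrow> (('l \<Rightarrow> 'k::field) \<Rightarrow> 'k) set" where
  "homogeneous_polys L d = {F. \<exists>A c. finite A \<and> A \<subseteq> {\<alpha> :: 'l \<Rightarrow> nat. (\<Sum>l\<in>L. \<alpha> l) = d} \<and>
     F = (\<lambda>v. \<Sum>\<alpha>\<in>A. c \<alpha> * (\<Prod>l\<in>L. v l ^ \<alpha> l))}"

text \<open>
  The point with homogeneous coordinates \<open>v\<close> is the set of all its coordinate vectors.
\<close>

definition proj_point :: "'l set \<Rightarrow> ('l \<Rightarrow> 'k::field) \<Rightarrow> ('l \<Rightarrow> 'k) set" where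
  "proj_point L v = {(\<lambda>l\<in>L. c * v l) |c. c \<noteq> 0}"

definition proj_points :: "'l set \<Rightarrow> ('l \<Rightarrow> 'k::field) set set" where
  "proj_points L = {proj_point L v |v. v \<in> extensional L \<and> (\<exists>l\<in>L. v l \<noteq> 0)}"

definition proj_zariski :: "'l set \<Rightarrow> ('l \<Rightarrow> 'k::field) set topology" where
  "proj_zariski L = topology_generated_by
     {{P \<in> proj_points L. \<forall>v \<in> P. F v \<noteq> 0} |F. \<exists>d. F \<in> homogeneous_polys L d}"

definition proj_fractions ::
  "'l set \<Rightarrow> ((('l \<Rightarrow> 'k::field) set \<Rightarrow> 'k) \<times> (('l \<Rightarrow> 'k) set \<Rightarrow> 'k)) set" where
  "proj_fractions L = {(\<lambda>P. F (rep P), \<lambda>P. G (rep P)) |F G rep.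
     (\<exists>d. F \<in> homogeneous_polys L d \<and> G \<in> homogeneous_polys L d) \<and>
     (\<forall>P \<in> proj_points L. rep P \<in> P)}"

definition diagonal :: "'l set \<Rightarrow> ('l \<Rightarrow> 'k::field) set" where
  "diagonal L = {(\<lambda>l\<in>L. c) |c. c \<noteq> 0}"

definition projective_space ::
  "'l set \<Rightarrow> (('l \<Rightarrow> 'k::field) set, 'k, ('l \<Rightarrow> 'k) set) toric_variety" where
  "projective_space L =
     \<lparr>zariski = proj_zariski L,
      regular = locally_fraction (proj_zariski L) (proj_fractions L),
      torus = torus_power L Mod diagonal L,
      embed = (\<lambda>C. the_elem (proj_point L ` C))\<rparr>"


section \<open>The torus of pairs\<close>

abbreviation pairs :: "'a set \<Rightarrow> 'a set set" where
  "pairs S \<equiv> nsets S 2"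

definition mult_image :: "'a set \<Rightarrow> ('a set \<Rightarrow> 'k::field) set" where
  "mult_image S = (\<lambda>t. \<lambda>e\<in>pairs S. \<Prod>a\<in>e. t a) ` carrier (torus_power S)"

definition add_image :: "'a set \<Rightarrow> ('a set \<Rightarrow> real) set" where
  "add_image S = (\<lambda>w. \<lambda>e\<in>pairs S. \<Sum>a\<in>e. w a) ` carrier (real_power S)"

definition pair_torus :: "'a set \<Rightarrow> ('a set \<Rightarrow> 'k::field) set monoid" where
  "pair_torus S = torus_power (pairs S) Mod mult_image S"

definition ratio_map :: "'a set \<Rightarrow> 'a \<Rightarrow> 'a \<Rightarrow> ('a set \<Rightarrow> 'k::field) set \<Rightarrow> ('a \<Rightarrow> 'k) set" where
  "ratio_map S i j C = the_elem
     ((\<lambda>p. diagonal (S - {i, j}) #>\<^bsub>torus_power (S - {i, j})\<^esub> (\<lambda>l\<in>S - {i, j}. p {j, l} / p {i, l})) ` C)"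


section \<open>Stable marked trees and their fan\<close>

text \<open>
  \<open>leg a\<close> is the vertex to which the leg with label \<open>a\<close> is attached.
\<close>

record ('v, 'a) marked_tree =
  verts :: "'v set"
  edges :: "'v set set"
  leg :: "'a \<Rightarrow> 'v"

definition simple_path :: "('v, 'a) marked_tree \<Rightarrow> 'v \<Rightarrow> 'v \<Rightarrow> 'v list \<Rightarrow> bool" where
  "simple_path \<tau> u v vs \<longleftrightarrow> vs \<noteq> [] \<and> hd vs = u \<and> last vs = v \<and> distinct vs \<and>
     set vs \<subseteq> verts \<tau> \<and> successively (\<lambda>x y. {x, y} \<in> edges \<tau>) vs"

definition stable_tree :: "'a set \<Rightarrow> ('v, 'a) marked_tree \<Rightarrow> bool" where
  "stable_tree S \<tau> \<longleftrightarrow>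
     finite (verts \<tau>) \<and> verts \<tau> \<noteq> {} \<and> edges \<tau> \<subseteq> pairs (verts \<tau>) \<and>
     (\<forall>u \<in> verts \<tau>. \<forall>v \<in> verts \<tau>. \<exists>!vs. simple_path \<tau> u v vs) \<and>
     leg \<tau> ` S \<subseteq> verts \<tau> \<and>
     (\<forall>v \<in> verts \<tau>. 3 \<le> card {e \<in> edges \<tau>. v \<in> e} + card {a \<in> S. leg \<tau> a = v})"

definition tree_dist :: "('v, 'a) marked_tree \<Rightarrow> ('v set \<Rightarrow> real) \<Rightarrow> 'v \<Rightarrow> 'v \<Rightarrow> real" where
  "tree_dist \<tau> len u v =
     (let vs = (THE vs. simple_path \<tau> u v vs) in \<Sum>(x, y)\<leftarrow>zip vs (tl vs). len {x, y})"

text \<open>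
  Edges of length zero occur on the boundary of the cone; there the metric tree is obtained by
  contracting these edges, and the formula for the distance is unchanged.
\<close>

definition tree_cone :: "'a set \<Rightarrow> ('v, 'a) marked_tree \<Rightarrow> ('a set \<Rightarrow> real) set set" where
  "tree_cone S \<tau> = {add_image S #>\<^bsub>real_power (pairs S)\<^esub> w |w len.
     (\<forall>e \<in> edges \<tau>. 0 \<le> len e) \<and> w \<in> carrier (real_power (pairs S)) \<and>
     (\<forall>a \<in> S. \<forall>b \<in> S. a \<noteq> b \<longrightarrow> w {a, b} = - (1 / 2) * tree_dist \<tau> len (leg \<tau> a) (leg \<tau> b))}"

text \<open>
  Every finite tree is isomorphic to one whose vertices are natural numbers, and isomorphic trees
  have the same cone.
\<close>

definition tree_fan :: "'a set \<Rightarrow> ('a set \<Rightarrow> real) set set set" where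
  "tree_fan S = {tree_cone S \<tau> |\<tau> :: (nat, 'a) marked_tree. stable_tree S \<tau>}"

definition tree_fan_variety ::
  "'a set \<Rightarrow> ((('a set \<Rightarrow> real) set set \<times> (('a set \<Rightarrow> int) \<Rightarrow> 'k::field)) set, 'k,
     ('a set \<Rightarrow> 'k) set) toric_variety" where
  "tree_fan_variety S = fan_data.toric_variety_of_fan
     (character_lattice (pairs S) (mult_image S :: ('a set \<Rightarrow> 'k) set))
     (real_power (pairs S) Mod add_image S)
     (pairing (pairs S))
     (pair_torus S)
     (character (pairs S))
     (tree_fan S)"

end

theory Submission
  imports Defs
begin


text \<open>
  A homomorphism of tori extends to the toric varieties of two fans as soon as it maps every cone of
  the first fan into a cone of the second.  The cones of the fan of projective space with
  coordinates indexed by \<open>L\<close> belong to the affine charts: the cone of \<open>l0\<close> is where all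
  the characters \<open>X_l / X_l0\<close> are nonnegative.  For the ratio map these characters pull back to
  \<open>(p_jl / p_il) / (p_jl0 / p_il0)\<close>, and their value on a metric tree is half of the
  difference of \<open>d_jl - d_il\<close> at \<open>l0\<close> and at \<open>l\<close>.  So the claim is that, for each stable tree, one
  label \<open>l0\<close> maximises \<open>d_jl - d_il\<close> for all edge lengths at once.

  This holds because \<open>d_jl - d_il\<close> depends only on the point where \<open>l\<close> branches off the
  path from \<open>i\<close> to \<open>j\<close>, and it weakly decreases as this point moves towards \<open>j\<close>.  A label that
  branches off closest to \<open>i\<close> does it, and which labels do so is determined by the
  combinatorial tree (\<open>uniform_maximum_tree_dist_diff\<close>, \<open>tree_cone_to_projective_cone\<close>).

  On the chart of a cone with label \<open>l0\<close>, the extended map has the homogeneous coordinates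
  \<open>x (\<mu> l l0)\<close>, where \<open>\<mu> l l0\<close> is the pullback of \<open>X_l / X_l0\<close>.  A homogeneous polynomial in
  these is a linear combination of characters in the dual monoid, hence a regular function; this
  gives continuity and the pullback of regular functions.  The cocycle identity for \<open>\<mu>\<close> shows that
  the result depends neither on \<open>l0\<close> nor on the chart (\<open>coords_change\<close>, \<open>proj_map_morphism\<close>).  On the
  chart of the zero cone, which is the cone of the tree with one vertex, the
  map is the given homomorphism of tori.
\<close>


section \<open>Distances in trees\<close>

definition path_length :: "('v set \<Rightarrow> real) \<Rightarrow> 'v list \<Rightarrow> real" where
  "path_length len vs = (\<Sum>(x, y)\<leftarrow>zip vs (tl vs). len {x, y})"

lemma path_length_simps [simp]:
  "path_length len [] = 0"
  "path_length len [x] = 0"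
  "path_length len (x # y # vs) = len {x, y} + path_length len (y # vs)"
  by (simp_all add: path_length_def)

lemma path_length_append:
  "path_length len (xs @ y # ys) = path_length len (xs @ [y]) + path_length len (y # ys)"
proof (induction xs)
  case (Cons x xs)
  then show ?case by (cases xs) auto
qed simp

lemma path_length_rev: "path_length len (rev vs) = path_length len vs"
proof (induction vs)
  case (Cons x vs)
  then show ?case
  proof (cases vs)
    case (Cons y ws)
    then have "path_length len (rev (x # vs)) = path_length len (rev ws @ y # [x])"
      by simp
    also have "\<dots> = path_length len (rev vs) + len {x, y}"
      by (subst path_length_append) (simp add: Cons insert_commute)
    finally show ?thesis using Cons.IH Cons by simp
  qed simp
qed simp

lemma path_length_mono:
  assumes "successively (\<lambda>x y. {x, y} \<in> E) (xs @ ys)" and "\<forall>e\<in>E. 0 \<le> len e"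
  shows "path_length len xs \<le> path_length len (xs @ ys)"
    and "path_length len ys \<le> path_length len (xs @ ys)"
proof -
  have nonneg: "0 \<le> path_length len vs" if "successively (\<lambda>x y. {x, y} \<in> E) vs" for vs
    using that assms(2) by (induction vs rule: induct_list012) auto
  show "path_length len ys \<le> path_length len (xs @ ys)"
    using assms
  proof (induction xs)
    case (Cons x xs)
    then show ?case
      by (cases "xs @ ys") (auto intro: order_trans add_increasing)
  qed simp
  show "path_length len xs \<le> path_length len (xs @ ys)"
    using assms
  proof (induction xs rule: induct_list012)
    case (2 x)
    then show ?case using nonneg[of "x # ys"] by simp
  qed (auto simp: nonneg)
qed

lemma tree_dist_eq_path_length:
  assumes "stable_tree S \<tau>" "u \<in> verts \<tau>" "v \<in> verts \<tau>" "simple_path \<tau> u v vs"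
  shows "tree_dist \<tau> len u v = path_length len vs"
proof -
  have "(THE vs. simple_path \<tau> u v vs) = vs"
    using assms unfolding stable_tree_def by (intro the1_equality) auto
  then show ?thesis by (simp add: tree_dist_def path_length_def)
qed

text \<open>
  The path from \<open>u\<close> to \<open>x\<close> follows the path \<open>p\<close> from \<open>u\<close> to \<open>v\<close> up to the last vertex that the
  two have in common, the projection of \<open>x\<close> to \<open>p\<close>.  The path from \<open>v\<close> to \<open>x\<close> branches off at the
  same vertex, so the detour from \<open>p\<close> to \<open>x\<close> cancels in the difference of the two distances.  The
  number \<open>k\<close> is the position of the projection in \<open>p\<close>; it is the same for all edge lengths.
\<close>

lemma tree_dist_diff:
  assumes tree: "stable_tree S \<tau>" and uv: "u \<in> verts \<tau>" "v \<in> verts \<tau>"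
    and p: "simple_path \<tau> u v p" and x: "x \<in> verts \<tau>"
  shows "\<exists>k. \<forall>len. tree_dist \<tau> len v x - tree_dist \<tau> len u x =
           path_length len (drop k p) - path_length len (take (Suc k) p)"
proof -
  obtain q where q: "simple_path \<tau> u x q"
    using tree uv x unfolding stable_tree_def by blast
  have "u \<in> set p" "u \<in> set q"
    using p q by (auto simp: simple_path_def dest: hd_in_set)
  then have "\<exists>y\<in>set q. y \<in> set p" by blast
  then obtain qs y zs where q_split: "q = qs @ y # zs" and y: "y \<in> set p"
    and zs: "\<forall>z\<in>set zs. z \<notin> set p"
    by (rule split_list_last_propE)
  obtain ps rs where p_split: "p = ps @ y # rs"
    using y by (meson split_list)
  let ?adj = "\<lambda>a b. {a, b} \<in> edges \<tau>"
  have adj_p: "successively ?adj (ps @ [y])" "successively ?adj (y # rs)"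
    using p unfolding p_split simple_path_def
    by (auto simp: successively_append_iff successively_Cons)
  have adj_q: "successively ?adj (y # zs)"
    using q unfolding q_split simple_path_def
    by (auto simp: successively_append_iff)
  have end_q: "last (y # zs) = x"
    using q unfolding q_split simple_path_def by auto
  have disj: "set zs \<inter> set (ps @ y # rs) = {}"
    using zs p_split by auto
  have verts: "set (ps @ y # rs) \<subseteq> verts \<tau>" "set zs \<subseteq> verts \<tau>"
    using p q unfolding p_split q_split simple_path_def by auto
  have dist: "distinct (ps @ y # rs)" "distinct zs"
    using p q unfolding p_split q_split simple_path_def by auto
  have "simple_path \<tau> u x (ps @ y # zs)"
    using p end_q adj_p(1) adj_q disj verts dist
    unfolding p_split simple_path_def
    by (auto simp: successively_append_iff hd_append split: if_splits)
  then have du: "tree_dist \<tau> len u x = path_length len (ps @ [y]) + path_length len (y # zs)" for len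
    by (simp add: tree_dist_eq_path_length[OF tree uv(1) x] path_length_append[of len ps y zs])
  have "successively ?adj (rev (y # rs))"
    unfolding successively_rev using adj_p(2) by (simp add: insert_commute)
  then have "successively ?adj (rev rs @ y # zs)"
    using adj_q by (auto simp: successively_append_iff)
  moreover have "hd (rev rs @ y # zs) = v"
    using p unfolding p_split simple_path_def
    by (cases rs rule: rev_cases) auto
  ultimately have "simple_path \<tau> v x (rev rs @ y # zs)"
    using end_q disj verts dist unfolding simple_path_def by auto
  then have "tree_dist \<tau> len v x = path_length len (rev rs @ [y]) + path_length len (y # zs)" for len
    by (simp add: tree_dist_eq_path_length[OF tree uv(2) x] path_length_append[of len "rev rs" y zs])
  moreover have "path_length len (rev rs @ [y]) = path_length len (y # rs)" for len
    using path_length_rev[of len "y # rs"] by simp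
  ultimately have "\<forall>len. tree_dist \<tau> len v x - tree_dist \<tau> len u x =
      path_length len (drop (length ps) p) - path_length len (take (Suc (length ps)) p)"
    by (simp add: du p_split)
  then show ?thesis by blast
qed

text \<open>
  By the previous lemma the difference of the distances to \<open>v\<close> and to \<open>u\<close> weakly decreases as the
  projection to the path from \<open>u\<close> to \<open>v\<close> moves towards \<open>v\<close>.  A label whose projection is closest
  to \<open>u\<close> therefore maximises it for all edge lengths at once; this uniformity is what
  makes a whole cone of the fan land in a single cone of the fan of projective space.
\<close>

lemma uniform_maximum_tree_dist_diff:
  assumes tree: "stable_tree S \<tau>" and uv: "u \<in> verts \<tau>" "v \<in> verts \<tau>"
    and X: "finite X" "X \<noteq> {}" "f ` X \<subseteq> verts \<tau>"
  shows "\<exists>l0\<in>X. \<forall>l\<in>X. \<forall>len. (\<forall>e\<in>edges \<tau>. 0 \<le> len e) \<longrightarrow>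
    tree_dist \<tau> len v (f l) - tree_dist \<tau> len u (f l) \<le>
    tree_dist \<tau> len v (f l0) - tree_dist \<tau> len u (f l0)"
proof -
  obtain p where p: "simple_path \<tau> u v p"
    using tree uv unfolding stable_tree_def by blast
  have "\<forall>l\<in>X. \<exists>k. \<forall>len. tree_dist \<tau> len v (f l) - tree_dist \<tau> len u (f l) =
      path_length len (drop k p) - path_length len (take (Suc k) p)"
    using tree_dist_diff[OF tree uv p] X(3) by blast
  then obtain k where k: "\<And>l len. l \<in> X \<Longrightarrow> tree_dist \<tau> len v (f l) - tree_dist \<tau> len u (f l) =
      path_length len (drop (k l) p) - path_length len (take (Suc (k l)) p)"
    by metis
  obtain l0 where l0: "l0 \<in> X" "\<And>l. l \<in> X \<Longrightarrow> k l0 \<le> k l"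
    using ex_min_if_finite[of "k ` X"] X(1,2) by (metis (no_types, lifting) finite_imageI
        image_iff image_is_empty linorder_not_le)
  have "path_length len (drop (k l) p) - path_length len (take (Suc (k l)) p) \<le>
      path_length len (drop (k l0) p) - path_length len (take (Suc (k l0)) p)"
    if l: "l \<in> X" and len: "\<forall>e\<in>edges \<tau>. 0 \<le> len e" for l len
  proof -
    let ?adj = "\<lambda>a b. {a, b} \<in> edges \<tau>"
    have adj: "successively ?adj (take a p)" "successively ?adj (drop a p)" for a
      using p append_take_drop_id[of a p] successively_append_iff[of ?adj "take a p" "drop a p"]
      unfolding simple_path_def by auto
    have le: "k l0 \<le> k l" using l0(2) l .
    have "take (Suc (k l)) p = take (Suc (k l0)) p @ drop (Suc (k l0)) (take (Suc (k l)) p)"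
      using le append_take_drop_id[of "Suc (k l0)" "take (Suc (k l)) p"] by (simp add: min_def)
    then have "path_length len (take (Suc (k l0)) p) \<le> path_length len (take (Suc (k l)) p)"
      using path_length_mono(1)[OF _ len] adj(1) by metis
    moreover have "drop (k l0) p = take (k l - k l0) (drop (k l0) p) @ drop (k l) p"
      using le append_take_drop_id[of "k l - k l0" "drop (k l0) p"] by simp
    then have "path_length len (drop (k l) p) \<le> path_length len (drop (k l0) p)"
      using path_length_mono(2)[OF _ len] adj(2) by metis
    ultimately show ?thesis by linarith
  qed
  then show ?thesis
    using l0(1) k by (intro bexI[of _ l0]) auto
qed

section \<open>Quotient tori and their characters\<close>

lemma group_hom_between_quotients:
  assumes N: "N \<lhd> G" and D: "D \<lhd> H" and h: "h \<in> hom G H" and hN: "h ` N \<subseteq> D"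
  defines "q \<equiv> \<lambda>C. the_elem ((\<lambda>x. D #>\<^bsub>H\<^esub> h x) ` C)"
  shows "\<And>x. x \<in> carrier G \<Longrightarrow> q (N #>\<^bsub>G\<^esub> x) = D #>\<^bsub>H\<^esub> h x"
    and "q \<in> hom (G Mod N) (H Mod D)"
proof -
  interpret N: normal N G by (rule N)
  interpret D: normal D H by (rule D)
  have hc: "h x \<in> carrier H" if "x \<in> carrier G" for x
    using h that by (auto simp: hom_def)
  show q: "q (N #>\<^bsub>G\<^esub> x) = D #>\<^bsub>H\<^esub> h x" if x: "x \<in> carrier G" for x
    unfolding q_def
  proof (rule the_elem_image_unique)
    show "N #>\<^bsub>G\<^esub> x \<noteq> {}"
      using N.rcos_self[OF x N.is_subgroup] by auto
    fix y assume "y \<in> N #>\<^bsub>G\<^esub> x"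
    then obtain n where n: "n \<in> N" "y = n \<otimes>\<^bsub>G\<^esub> x" by (auto simp: r_coset_def)
    then have "h y = h n \<otimes>\<^bsub>H\<^esub> h x" using h x by (auto simp: hom_def)
    moreover have hn: "h n \<in> D" using n hN by auto
    ultimately have "D #>\<^bsub>H\<^esub> h y = (D #>\<^bsub>H\<^esub> h n) #>\<^bsub>H\<^esub> h x"
      using D.coset_mult_assoc[OF D.subset _ hc[OF x], of "h n"] by auto
    then show "D #>\<^bsub>H\<^esub> h y = D #>\<^bsub>H\<^esub> h x"
      using D.rcos_const[OF D.is_group hn] by simp
  qed
  show "q \<in> hom (G Mod N) (H Mod D)"
  proof (rule homI)
    fix A B assume "A \<in> carrier (G Mod N)" "B \<in> carrier (G Mod N)"
    then obtain a b where ab: "a \<in> carrier G" "b \<in> carrier G" "A = N #>\<^bsub>G\<^esub> a" "B = N #>\<^bsub>G\<^esub> b"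
      by (auto simp: carrier_FactGroup)
    show "q A \<in> carrier (H Mod D)"
      using ab q hc by (auto simp: carrier_FactGroup)
    have "h (a \<otimes>\<^bsub>G\<^esub> b) = h a \<otimes>\<^bsub>H\<^esub> h b" using h ab by (auto simp: hom_def)
    then show "q (A \<otimes>\<^bsub>G Mod N\<^esub> B) = q A \<otimes>\<^bsub>H Mod D\<^esub> q B"
      using ab q hc by (simp add: N.rcos_sum D.rcos_sum)
  qed
qed

lemma comm_group_mult_group: "comm_group (mult_group :: 'k::field monoid)"
proof (rule comm_groupI)
  show "\<exists>y\<in>carrier mult_group. y \<otimes>\<^bsub>mult_group\<^esub> x = \<one>\<^bsub>mult_group\<^esub>"
    if "x \<in> carrier (mult_group :: 'k monoid)" for x
    using that by (auto simp: mult_group_def intro!: bexI[of _ "inverse x"])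
qed (auto simp: mult_group_def)

lemma comm_group_real_group: "comm_group real_group"
proof (rule comm_groupI)
  show "\<exists>y\<in>carrier real_group. y \<otimes>\<^bsub>real_group\<^esub> x = \<one>\<^bsub>real_group\<^esub>" for x
    by (auto simp: real_group_def intro!: exI[of _ "- x"])
qed (auto simp: real_group_def)

lemma comm_group_product_group:
  assumes "\<And>i. i \<in> I \<Longrightarrow> comm_group (G i)"
  shows "comm_group (product_group I G)"
proof (rule group.group_comm_groupI)
  show "group (product_group I G)"
    using assms by (simp add: comm_group_def)
  fix x y assume "x \<in> carrier (product_group I G)" "y \<in> carrier (product_group I G)"
  then show "x \<otimes>\<^bsub>product_group I G\<^esub> y = y \<otimes>\<^bsub>product_group I G\<^esub> x"
    using assms by (auto intro!: restrict_ext comm_monoid.m_comm simp: comm_group_def PiE_iff)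
qed

lemma comm_group_torus_power: "comm_group (torus_power I :: ('i \<Rightarrow> 'k::field) monoid)"
  by (intro comm_group_product_group comm_group_mult_group)

lemma comm_group_real_power: "comm_group (real_power I)"
  by (intro comm_group_product_group comm_group_real_group)

lemma torus_power_carrier: "t \<in> carrier (torus_power I) \<longleftrightarrow> t \<in> extensional I \<and> (\<forall>i\<in>I. t i \<noteq> 0)"
  by (auto simp: mult_group_def PiE_iff)

lemma torus_power_mult: "s \<otimes>\<^bsub>torus_power I\<^esub> t = (\<lambda>i\<in>I. s i * t i)"
  by (simp add: mult_group_def)

lemma real_power_carrier: "w \<in> carrier (real_power I) \<longleftrightarrow> w \<in> extensional I"
  by (auto simp: real_group_def PiE_iff)

lemma real_power_mult: "v \<otimes>\<^bsub>real_power I\<^esub> w = (\<lambda>i\<in>I. v i + w i)"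
  by (simp add: real_group_def)

lemma subgroup_hom_image:
  assumes "comm_group G" "comm_group H" "h \<in> hom G H"
  shows "h ` carrier G \<lhd> H"
proof -
  interpret group_hom G H h
    using assms by (auto simp: group_hom_def group_hom_axioms_def comm_group_def)
  show ?thesis
    using comm_group.subgroup_imp_normal[OF assms(2) img_is_subgroup] .
qed

lemma diagonal_normal: "diagonal L \<lhd> (torus_power L :: ('l \<Rightarrow> 'k::field) monoid)"
proof -
  have "(\<lambda>c. \<lambda>l\<in>L. c) \<in> hom mult_group (torus_power L :: ('l \<Rightarrow> 'k) monoid)"
    by (rule homI) (auto simp: mult_group_def)
  moreover have "diagonal L = (\<lambda>c. \<lambda>l\<in>L. c :: 'k) ` carrier mult_group"
    by (auto simp: diagonal_def mult_group_def)
  ultimately show ?thesis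
    by (simp only: subgroup_hom_image comm_group_mult_group comm_group_torus_power)
qed

lemma pairs_subset: "e \<in> pairs S \<Longrightarrow> finite e \<and> e \<subseteq> S"
  by (auto simp: nsets_def)

lemma mult_image_normal: "mult_image S \<lhd> (torus_power (pairs S) :: ('a set \<Rightarrow> 'k::field) monoid)"
  unfolding mult_image_def
proof (rule subgroup_hom_image[OF comm_group_torus_power comm_group_torus_power], rule homI)
  fix s t :: "'a \<Rightarrow> 'k" assume st: "s \<in> carrier (torus_power S)" "t \<in> carrier (torus_power S)"
  show "(\<lambda>e\<in>pairs S. \<Prod>a\<in>e. s a) \<in> carrier (torus_power (pairs S))"
    using st(1) pairs_subset unfolding torus_power_carrier by fastforce
  have "(\<Prod>a\<in>e. (\<lambda>a\<in>S. s a * t a) a) = (\<Prod>a\<in>e. s a) * (\<Prod>a\<in>e. t a)" if "e \<in> pairs S" for e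
    using pairs_subset[OF that]
    by (subst prod.distrib[symmetric]) (intro prod.cong, auto)
  then show "(\<lambda>e\<in>pairs S. \<Prod>a\<in>e. (s \<otimes>\<^bsub>torus_power S\<^esub> t) a) =
      (\<lambda>e\<in>pairs S. \<Prod>a\<in>e. s a) \<otimes>\<^bsub>torus_power (pairs S)\<^esub> (\<lambda>e\<in>pairs S. \<Prod>a\<in>e. t a)"
    unfolding torus_power_mult by (intro restrict_ext) simp
qed

lemma add_image_normal: "add_image S \<lhd> real_power (pairs S)"
  unfolding add_image_def
proof (rule subgroup_hom_image[OF comm_group_real_power comm_group_real_power], rule homI)
  fix v w :: "'a \<Rightarrow> real" assume "v \<in> carrier (real_power S)" "w \<in> carrier (real_power S)"
  show "(\<lambda>e\<in>pairs S. \<Sum>a\<in>e. v a) \<in> carrier (real_power (pairs S))"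
    by (simp add: real_power_carrier del: carrier_product_group)
  have "(\<Sum>a\<in>e. (\<lambda>a\<in>S. v a + w a) a) = (\<Sum>a\<in>e. v a) + (\<Sum>a\<in>e. w a)" if "e \<in> pairs S" for e
    using pairs_subset[OF that]
    by (subst sum.distrib[symmetric]) (intro sum.cong, auto)
  then show "(\<lambda>e\<in>pairs S. \<Sum>a\<in>e. (v \<otimes>\<^bsub>real_power S\<^esub> w) a) =
      (\<lambda>e\<in>pairs S. \<Sum>a\<in>e. v a) \<otimes>\<^bsub>real_power (pairs S)\<^esub> (\<lambda>e\<in>pairs S. \<Sum>a\<in>e. w a)"
    unfolding real_power_mult by (intro restrict_ext) simp
qed

lemma monomial_add:
  assumes "t \<in> carrier (torus_power I)"
  shows "monomial I (\<lambda>i\<in>I. m i + m' i) t = monomial I m t * monomial I m' t"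
  using assms unfolding torus_power_carrier monomial_def
  by (simp add: prod.distrib power_int_add)

lemma monomial_mult:
  "monomial I m (s \<otimes>\<^bsub>torus_power I\<^esub> t) = monomial I m s * monomial I m t"
  unfolding monomial_def torus_power_mult
  by (simp add: prod.distrib power_int_mult_distrib)

lemma monomial_zero: "monomial I (\<lambda>i\<in>I. 0) t = 1"
  by (simp add: monomial_def)

lemma in_character_lattice:
  "m \<in> carrier (character_lattice I H) \<longleftrightarrow> m \<in> extensional I \<and> (\<forall>t\<in>H. monomial I m t = 1)"
  by (auto simp: character_lattice_def PiE_iff)

lemma character_lattice_mult [simp]:
  "m \<otimes>\<^bsub>character_lattice I H\<^esub> m' = (\<lambda>i\<in>I. m i + m' i)"
  by (simp add: character_lattice_def)

lemma character_lattice_one [simp]: "\<one>\<^bsub>character_lattice I H\<^esub> = (\<lambda>i\<in>I. 0)"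
  by (simp add: character_lattice_def)

lemma comm_monoid_character_lattice:
  assumes "H \<subseteq> carrier (torus_power I)"
  shows "comm_monoid (character_lattice I H)"
proof (rule comm_monoidI)
  show "m \<otimes>\<^bsub>character_lattice I H\<^esub> m' \<in> carrier (character_lattice I H)"
    if "m \<in> carrier (character_lattice I H)" "m' \<in> carrier (character_lattice I H)" for m m'
    using that monomial_add assms by (fastforce simp: in_character_lattice subset_iff)
  show "\<one>\<^bsub>character_lattice I H\<^esub> \<in> carrier (character_lattice I H)"
    by (simp add: in_character_lattice monomial_zero)
  show "\<one>\<^bsub>character_lattice I H\<^esub> \<otimes>\<^bsub>character_lattice I H\<^esub> m = m"
    if "m \<in> carrier (character_lattice I H)" for m
    using that by (auto simp: in_character_lattice fun_eq_iff extensional_def)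
qed (auto intro!: restrict_ext)

lemma character_coset:
  assumes H: "H \<lhd> torus_power I" and m: "m \<in> carrier (character_lattice I H)"
    and p: "p \<in> carrier (torus_power I)"
  shows "character I m (H #>\<^bsub>torus_power I\<^esub> p) = monomial I m p"
  unfolding character_def
proof (rule the_elem_image_unique)
  interpret H: normal H "torus_power I" by (rule H)
  show "H #>\<^bsub>torus_power I\<^esub> p \<noteq> {}"
    using H.rcos_self[OF p H.is_subgroup] by blast
  fix q assume "q \<in> H #>\<^bsub>torus_power I\<^esub> p"
  then obtain h where "h \<in> H" "q = h \<otimes>\<^bsub>torus_power I\<^esub> p" unfolding r_coset_def by blast
  then show "monomial I m q = monomial I m p"
    using m by (simp only: monomial_mult in_character_lattice mult_1)
qed

text \<open>
  Evaluating the character at the image of the vector with one entry 2 and all others 1 gives a power of 2,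
  and in characteristic zero this is 1 only if the exponent is zero.
\<close>

lemma character_degree_zero:
  assumes S: "finite S" and a: "a \<in> S"
    and m: "m \<in> carrier (character_lattice (pairs S) (mult_image S :: ('a set \<Rightarrow> 'k::field_char_0) set))"
  shows "(\<Sum>e | e \<in> pairs S \<and> a \<in> e. m e) = 0"
proof -
  let ?t = "\<lambda>b\<in>S. if b = a then 2 else (1 :: 'k)"
  have fin: "finite (pairs S)" using S by (simp add: finite_imp_finite_nsets)
  have two_pow: "k = 0" if "(2::'k) ^ k = 1" for k
  proof -
    have "of_nat (2 ^ k) = (of_nat 1 :: 'k)" using that by simp
    then have "2 ^ k = (1 :: nat)" unfolding of_nat_eq_iff .
    then show ?thesis by simp
  qed
  have two_powi: "n = 0" if "(2::'k) powi n = 1" for n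
    using that two_pow[of "nat n"] two_pow[of "nat (- n)"]
    by (auto simp: power_int_def power_divide split: if_splits)
  have t: "(\<Prod>b\<in>e. ?t b) = (if a \<in> e then 2 else 1)" if "e \<in> pairs S" for e
  proof -
    have "(\<Prod>b\<in>e. ?t b) = (\<Prod>b\<in>e. if b = a then 2 else 1)"
      using pairs_subset[OF that] by (intro prod.cong) auto
    then show ?thesis using pairs_subset[OF that] by simp
  qed
  have "?t \<in> carrier (torus_power S)"
    unfolding torus_power_carrier by simp
  then have "(\<lambda>e\<in>pairs S. \<Prod>b\<in>e. ?t b) \<in> mult_image S"
    unfolding mult_image_def by blast
  then have "1 = monomial (pairs S) m (\<lambda>e\<in>pairs S. \<Prod>b\<in>e. ?t b)"
    using m unfolding in_character_lattice by simp
  also have "\<dots> = (\<Prod>e\<in>pairs S. if a \<in> e then 2 powi m e else 1)"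
    unfolding monomial_def using t by (intro prod.cong) auto
  also have "\<dots> = (\<Prod>e | e \<in> pairs S \<and> a \<in> e. 2 powi m e)"
    using fin by (simp add: prod.inter_filter)
  also have "\<dots> = 2 powi (\<Sum>e | e \<in> pairs S \<and> a \<in> e. m e)"
    using fin by (induction rule: infinite_finite_induct) (auto simp: power_int_add)
  finally show ?thesis using two_powi by simp
qed

text \<open>
  The pairing with the image of a vector \<open>v\<close> is \<open>v\<close> paired with the degrees of the character at the
  single labels, which vanish by the previous lemma.
\<close>

lemma pairing_coset:
  assumes S: "finite S"
    and m: "m \<in> carrier (character_lattice (pairs S) (mult_image S :: ('a set \<Rightarrow> 'k::field_char_0) set))"
    and w: "w \<in> carrier (real_power (pairs S))"
  shows "pairing (pairs S) m (add_image S #>\<^bsub>real_power (pairs S)\<^esub> w) =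
    (\<Sum>e\<in>pairs S. of_int (m e) * w e)"
  unfolding pairing_def
proof (rule the_elem_image_unique)
  interpret add: normal "add_image S" "real_power (pairs S)" by (rule add_image_normal)
  show "add_image S #>\<^bsub>real_power (pairs S)\<^esub> w \<noteq> {}"
    using add.rcos_self[OF w add.is_subgroup] by blast
  fix u assume "u \<in> add_image S #>\<^bsub>real_power (pairs S)\<^esub> w"
  then obtain v where "u = (\<lambda>e\<in>pairs S. \<Sum>a\<in>e. v a) \<otimes>\<^bsub>real_power (pairs S)\<^esub> w"
    unfolding r_coset_def add_image_def by blast
  then have u: "u e = (\<Sum>a\<in>e. v a) + w e" if "e \<in> pairs S" for e
    using that by (simp only: real_power_mult restrict_apply' cong: restrict_cong)
  have fin: "finite (pairs S)" using S by (simp add: finite_imp_finite_nsets)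
  have "(\<Sum>e\<in>pairs S. of_int (m e) * (\<Sum>a\<in>e. v a)) =
      (\<Sum>e\<in>pairs S. \<Sum>a | a \<in> S \<and> a \<in> e. of_int (m e) * v a)"
    using pairs_subset by (intro sum.cong) (auto simp: sum_distrib_left intro!: sum.cong)
  also have "\<dots> = (\<Sum>a\<in>S. \<Sum>e | e \<in> pairs S \<and> a \<in> e. of_int (m e) * v a)"
    using fin S by (rule sum.swap_restrict)
  also have "\<dots> = (\<Sum>a\<in>S. of_int (\<Sum>e | e \<in> pairs S \<and> a \<in> e. m e) * v a)"
    by (simp add: sum_distrib_right)
  also have "\<dots> = 0"
    using character_degree_zero[OF S _ m] by simp
  finally show "(\<Sum>e\<in>pairs S. of_int (m e) * u e) = (\<Sum>e\<in>pairs S. of_int (m e) * w e)"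
    by (simp add: u distrib_left sum.distrib)
qed

section \<open>Maps from the toric variety of a fan to projective space\<close>

lemma locally_fraction_cong:
  assumes f: "locally_fraction X Q U f" and eq: "\<And>x. x \<in> U \<Longrightarrow> f x = f' x"
  shows "locally_fraction X Q U f'"
  unfolding locally_fraction_def
proof
  fix x assume "x \<in> U"
  from bspec[OF f[unfolded locally_fraction_def] this] obtain W g h
    where W: "openin X W" "x \<in> W" "W \<subseteq> U" "(g, h) \<in> Q" "\<forall>y\<in>W. h y \<noteq> 0 \<and> f y = g y / h y"
    by (elim exE conjE)
  have "\<forall>y\<in>W. h y \<noteq> 0 \<and> f' y = g y / h y"
    using W(5) eq[OF subsetD[OF W(3)]] by simp
  with W show "\<exists>W g h. openin X W \<and> x \<in> W \<and> W \<subseteq> U \<and> (g, h) \<in> Q \<and>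
      (\<forall>y\<in>W. h y \<noteq> 0 \<and> f' y = g y / h y)"
    by (intro exI[of _ W] exI[of _ g] exI[of _ h] conjI)
qed

context fan_data
begin

lemma chart_zariski_topspace: "topspace (chart_zariski \<sigma>) = chart_points \<sigma>"
  if "\<one>\<^bsub>M\<^esub> \<in> dual_monoid \<sigma>"
proof -
  have "(\<lambda>x. x \<one>\<^bsub>M\<^esub>) \<in> chart_ring \<sigma>"
    unfolding chart_ring_def using that
    by (auto intro!: exI[of _ "{\<one>\<^bsub>M\<^esub>}"] exI[of _ "\<lambda>_. 1"])
  moreover have "{x \<in> chart_points \<sigma>. x \<one>\<^bsub>M\<^esub> \<noteq> 0} = chart_points \<sigma>"
    by (auto simp: chart_points_def)
  ultimately show ?thesis
    unfolding chart_zariski_def topology_generated_by_topspace by blast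
qed

lemma chart_basic_open:
  assumes "f \<in> chart_ring \<sigma>"
  shows "openin (chart_zariski \<sigma>) {x \<in> chart_points \<sigma>. f x \<noteq> 0}"
  unfolding chart_zariski_def
  by (rule topology_generated_by_Basis, intro CollectI exI[of _ f] conjI refl assms)

lemma chart_map_self:
  assumes "\<sigma> \<in> Sigma" "x \<in> chart_points \<sigma>"
  shows "(\<sigma>, x) \<in> chart_map \<sigma> x"
  using assms by (auto simp: chart_map_def glue_def chart_points_def extensional_restrict)

lemma chart_map_in_points:
  assumes "\<sigma> \<in> Sigma" "x \<in> chart_points \<sigma>"
  shows "chart_map \<sigma> x \<in> points"
  using assms by (auto simp: chart_map_def points_def intro!: quotientI)

lemma in_pointsE:
  assumes "C \<in> points"
  obtains \<sigma> x where "\<sigma> \<in> Sigma" "x \<in> chart_points \<sigma>" "C = chart_map \<sigma> x"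
  using assms by (auto simp: points_def chart_map_def elim!: quotientE)

end

text \<open>
  Additivity of the pairing makes the dual monoids of the cones into submonoids of the character
  lattice; then a monomial in the coordinates of a chart is again a coordinate of that chart.
\<close>

locale additive_fan = fan_data M N pair T chi Sigma
  for M :: "'m monoid" and N :: "'n monoid" and pair :: "'m \<Rightarrow> 'n \<Rightarrow> real"
    and T :: "'t monoid" and chi :: "'m \<Rightarrow> 't \<Rightarrow> 'k::field" and Sigma :: "'n set set" +
  assumes comm_monoid_M: "comm_monoid M"
    and pair_mult: "\<lbrakk>\<sigma> \<in> Sigma; u \<in> \<sigma>; m \<in> carrier M; m' \<in> carrier M\<rbrakk> \<Longrightarrow>
      pair (m \<otimes>\<^bsub>M\<^esub> m') u = pair m u + pair m' u"
begin

sublocale M: comm_monoid M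
  by (rule comm_monoid_M)

lemma one_in_dual_monoid: "\<sigma> \<in> Sigma \<Longrightarrow> \<one>\<^bsub>M\<^esub> \<in> dual_monoid \<sigma>"
  using pair_mult[of \<sigma> _ "\<one>\<^bsub>M\<^esub>" "\<one>\<^bsub>M\<^esub>"] by (auto simp: dual_monoid_def)

lemma mult_in_dual_monoid:
  "\<lbrakk>\<sigma> \<in> Sigma; m \<in> dual_monoid \<sigma>; m' \<in> dual_monoid \<sigma>\<rbrakk> \<Longrightarrow> m \<otimes>\<^bsub>M\<^esub> m' \<in> dual_monoid \<sigma>"
  using pair_mult by (auto simp: dual_monoid_def)

lemma monomial_as_character:
  assumes \<sigma>: "\<sigma> \<in> Sigma" and "finite L" and "\<And>l. l \<in> L \<Longrightarrow> \<nu> l \<in> dual_monoid \<sigma>"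
  shows "\<exists>m\<in>dual_monoid \<sigma>. \<forall>x\<in>chart_points \<sigma>. (\<Prod>l\<in>L. x (\<nu> l) ^ \<alpha> l) = x m"
  using assms(2,3)
proof (induction L)
  case empty
  then show ?case
    using one_in_dual_monoid[OF \<sigma>] by (auto simp: chart_points_def intro!: bexI[of _ "\<one>\<^bsub>M\<^esub>"])
next
  case (insert a L)
  have pow: "\<exists>m\<in>dual_monoid \<sigma>. \<forall>x\<in>chart_points \<sigma>. x (\<nu> a) ^ n = x m" for n
  proof (induction n)
    case 0
    then show ?case
      using one_in_dual_monoid[OF \<sigma>] by (auto simp: chart_points_def intro!: bexI[of _ "\<one>\<^bsub>M\<^esub>"])
  next
    case (Suc n)
    then obtain m where "m \<in> dual_monoid \<sigma>" "\<forall>x\<in>chart_points \<sigma>. x (\<nu> a) ^ n = x m" by blast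
    moreover have "\<nu> a \<in> dual_monoid \<sigma>" using insert.prems by simp
    ultimately show ?case
      using mult_in_dual_monoid[OF \<sigma>]
      by (intro bexI[of _ "\<nu> a \<otimes>\<^bsub>M\<^esub> m"]) (auto simp: chart_points_def)
  qed
  obtain m where "m \<in> dual_monoid \<sigma>" "\<forall>x\<in>chart_points \<sigma>. x (\<nu> a) ^ \<alpha> a = x m"
    using pow by blast
  moreover obtain m' where "m' \<in> dual_monoid \<sigma>"
      "\<forall>x\<in>chart_points \<sigma>. (\<Prod>l\<in>L. x (\<nu> l) ^ \<alpha> l) = x m'"
    using insert by auto
  ultimately show ?case
    using mult_in_dual_monoid[OF \<sigma>] insert.hyps
    by (intro bexI[of _ "m \<otimes>\<^bsub>M\<^esub> m'"]) (auto simp: chart_points_def)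
qed

text \<open>
  Different exponent vectors may give the same character, so the coefficients have to be
  collected along the fibres of the map from exponent vectors to characters.
\<close>

lemma homogeneous_poly_pullback:
  assumes \<sigma>: "\<sigma> \<in> Sigma" and "finite L" and "\<And>l. l \<in> L \<Longrightarrow> \<nu> l \<in> dual_monoid \<sigma>"
    and F: "F \<in> homogeneous_polys L d"
  shows "\<exists>f\<in>chart_ring \<sigma>. \<forall>x\<in>chart_points \<sigma>. f x = F (\<lambda>l\<in>L. x (\<nu> l))"
proof -
  obtain A c where A: "finite A" and F_eq: "F = (\<lambda>v. \<Sum>\<alpha>\<in>A. c \<alpha> * (\<Prod>l\<in>L. v l ^ \<alpha> l))"
    using F by (auto simp: homogeneous_polys_def)
  have "\<forall>\<alpha>. \<exists>m. m \<in> dual_monoid \<sigma> \<and> (\<forall>x\<in>chart_points \<sigma>. (\<Prod>l\<in>L. x (\<nu> l) ^ \<alpha> l) = x m)"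
    using monomial_as_character[of \<sigma> L \<nu>, OF \<sigma> assms(2,3)] by blast
  from choice[OF this] obtain e where e: "\<And>\<alpha>. e \<alpha> \<in> dual_monoid \<sigma>"
      "\<And>\<alpha> x. x \<in> chart_points \<sigma> \<Longrightarrow> (\<Prod>l\<in>L. x (\<nu> l) ^ \<alpha> l) = x (e \<alpha>)"
    by auto
  let ?f = "\<lambda>x. \<Sum>m\<in>e ` A. (\<Sum>\<alpha> | \<alpha> \<in> A \<and> e \<alpha> = m. c \<alpha>) * x m"
  have ring: "?f \<in> chart_ring \<sigma>"
    unfolding chart_ring_def using A e(1)
    by (auto intro!: exI[of _ "e ` A"] exI[of _ "\<lambda>m. \<Sum>\<alpha> | \<alpha> \<in> A \<and> e \<alpha> = m. c \<alpha>"])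
  have eq: "?f x = F (\<lambda>l\<in>L. x (\<nu> l))" if x: "x \<in> chart_points \<sigma>" for x
  proof -
    have "F (\<lambda>l\<in>L. x (\<nu> l)) = (\<Sum>\<alpha>\<in>A. c \<alpha> * x (e \<alpha>))"
      unfolding F_eq using e(2)[OF x] by simp
    also have "\<dots> = (\<Sum>m\<in>e ` A. \<Sum>\<alpha> | \<alpha> \<in> A \<and> e \<alpha> = m. c \<alpha> * x (e \<alpha>))"
      by (rule sum.image_gen[OF A])
    also have "\<dots> = ?f x"
      by (simp add: sum_distrib_right)
    finally show ?thesis by simp
  qed
  show ?thesis
    by (rule bexI[OF _ ring], rule ballI, rule eq)
qed

end

lemma homogeneous_poly_scale:
  assumes "F \<in> homogeneous_polys L d"
  shows "F (\<lambda>l\<in>L. c * v l) = c ^ d * F v"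
proof -
  obtain A b where A: "A \<subseteq> {\<alpha>. (\<Sum>l\<in>L. \<alpha> l) = d}"
      and F: "F = (\<lambda>v. \<Sum>\<alpha>\<in>A. b \<alpha> * (\<Prod>l\<in>L. v l ^ \<alpha> l))"
    using assms by (auto simp: homogeneous_polys_def)
  have "(\<Prod>l\<in>L. (c * v l) ^ \<alpha> l) = c ^ d * (\<Prod>l\<in>L. v l ^ \<alpha> l)" if "\<alpha> \<in> A" for \<alpha>
    using that A by (auto simp: power_mult_distrib prod.distrib simp flip: power_sum)
  then show ?thesis
    by (simp add: F sum_distrib_left mult.left_commute)
qed

lemma proj_point_scale:
  assumes "c \<noteq> 0" and "\<And>l. l \<in> L \<Longrightarrow> w l = c * v l"
  shows "proj_point L w = proj_point L v"
proof -
  have w: "(\<lambda>l\<in>L. b * w l) = (\<lambda>l\<in>L. (b * c) * v l)" for b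
    using assms(2) by (intro restrict_ext) (simp add: mult.assoc)
  show ?thesis
  proof (intro equalityI subsetI)
    fix y assume "y \<in> proj_point L w"
    then obtain b where "b \<noteq> 0" "y = (\<lambda>l\<in>L. (b * c) * v l)"
      unfolding proj_point_def w by blast
    then show "y \<in> proj_point L v"
      unfolding proj_point_def using assms(1) by (intro CollectI exI[of _ "b * c"]) simp
  next
    fix y assume "y \<in> proj_point L v"
    then obtain b where "b \<noteq> 0" "y = (\<lambda>l\<in>L. b * v l)"
      unfolding proj_point_def by blast
    then show "y \<in> proj_point L w"
      unfolding proj_point_def w using assms(1) by (intro CollectI exI[of _ "b / c"]) simp
  qed
qed

lemma proj_point_nonzero:
  assumes "F \<in> homogeneous_polys L d"
  shows "(\<forall>w\<in>proj_point L v. F w \<noteq> 0) \<longleftrightarrow> F v \<noteq> 0"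
proof
  assume "\<forall>w\<in>proj_point L v. F w \<noteq> 0"
  moreover have "(\<lambda>l\<in>L. 1 * v l) \<in> proj_point L v"
    unfolding proj_point_def by (intro CollectI exI[of _ 1]) simp
  ultimately show "F v \<noteq> 0"
    using homogeneous_poly_scale[OF assms, of 1 v] by force
next
  assume "F v \<noteq> 0"
  then show "\<forall>w\<in>proj_point L v. F w \<noteq> 0"
    by (auto simp: proj_point_def homogeneous_poly_scale[OF assms])
qed

lemma proj_zariski_topspace: "topspace (proj_zariski L) = proj_points L"
proof -
  have "(\<lambda>_. 1) \<in> homogeneous_polys L 0"
    unfolding homogeneous_polys_def
    by (auto intro!: exI[of _ "{\<lambda>_. 0}"] exI[of _ "\<lambda>_. 1"])
  \<comment> \<open>The nonvanishing locus of the constant 1 is all of projective space.\<close>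
  then have "proj_points L \<in> {{P \<in> proj_points L. \<forall>v\<in>P. F v \<noteq> 0} |F. \<exists>d. F \<in> homogeneous_polys L d}"
    by (auto intro!: exI[of _ "\<lambda>_. 1"])
  then show ?thesis
    unfolding proj_zariski_def topology_generated_by_topspace by blast
qed

text \<open>
  The family \<open>\<mu>\<close> stands for the quotients of homogeneous coordinates: \<open>\<mu> l l'\<close> is the pullback of the
  character \<open>X_l / X_l'\<close> of the torus of projective space.  The last assumption
  says that each cone of the fan is mapped into the cone of the standard fan of projective space
  that belongs to the affine chart where \<open>X_l0\<close> does not vanish.
\<close>

locale fan_to_projective = additive_fan M N pair T chi Sigma
  for M :: "'m monoid" and N :: "'n monoid" and pair :: "'m \<Rightarrow> 'n \<Rightarrow> real"
    and T :: "'t monoid" and chi :: "'m \<Rightarrow> 't \<Rightarrow> 'k::field" and Sigma :: "'n set set" +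
  fixes L :: "'l set" and \<mu> :: "'l \<Rightarrow> 'l \<Rightarrow> 'm"
  assumes finite_L: "finite L"
    and \<mu>_refl: "l \<in> L \<Longrightarrow> \<mu> l l = \<one>\<^bsub>M\<^esub>"
    and \<mu>_trans: "\<lbrakk>l \<in> L; l' \<in> L; l'' \<in> L\<rbrakk> \<Longrightarrow> \<mu> l l' \<otimes>\<^bsub>M\<^esub> \<mu> l' l'' = \<mu> l l''"
    and cone_to_cone: "\<sigma> \<in> Sigma \<Longrightarrow> \<exists>l0\<in>L. \<forall>l\<in>L. \<mu> l l0 \<in> dual_monoid \<sigma>"
begin

text \<open>
  A label \<open>l0\<close> is adapted to \<open>\<sigma>\<close> if the chart of \<open>\<sigma>\<close> is mapped into the affine chart of projective
  space where the coordinate with index \<open>l0\<close> does not vanish.  In \<open>coords l0\<close> this coordinate is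
  normalised to 1.
\<close>

definition adapted :: "'n set \<Rightarrow> 'l \<Rightarrow> bool" where
  "adapted \<sigma> l0 \<longleftrightarrow> l0 \<in> L \<and> (\<forall>l\<in>L. \<mu> l l0 \<in> dual_monoid \<sigma>)"

definition coords :: "'l \<Rightarrow> ('m \<Rightarrow> 'k) \<Rightarrow> 'l \<Rightarrow> 'k" where
  "coords l0 x = (\<lambda>l\<in>L. x (\<mu> l l0))"

definition proj_map :: "('n set \<times> ('m \<Rightarrow> 'k)) set \<Rightarrow> ('l \<Rightarrow> 'k) set" where
  "proj_map C = the_elem ((\<lambda>(\<sigma>, x). proj_point L (coords (SOME l0. adapted \<sigma> l0) x)) ` C)"

lemma adapted_exists: "\<sigma> \<in> Sigma \<Longrightarrow> \<exists>l0. adapted \<sigma> l0"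
  using cone_to_cone by (auto simp: adapted_def)

lemma adapted_some: "\<sigma> \<in> Sigma \<Longrightarrow> adapted \<sigma> (SOME l0. adapted \<sigma> l0)"
  using adapted_exists by (rule someI_ex)

lemma adapted_subset: "\<lbrakk>adapted \<sigma> l0; \<tau> \<subseteq> \<sigma>\<rbrakk> \<Longrightarrow> adapted \<tau> l0"
  by (auto simp: adapted_def dual_monoid_def)

text \<open>
  Changing the reference coordinate from \<open>l1\<close> to \<open>l0\<close> rescales the coordinate vector by
  \<open>x (\<mu> l1 l0)\<close>, which is invertible with inverse \<open>x (\<mu> l0 l1)\<close>.
\<close>

lemma coords_change:
  assumes x: "x \<in> chart_points \<sigma>" and l0: "adapted \<sigma> l0" and l1: "adapted \<sigma> l1"
  shows "proj_point L (coords l0 x) = proj_point L (coords l1 x)"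
proof (rule proj_point_scale)
  have L: "l0 \<in> L" "l1 \<in> L" using l0 l1 by (auto simp: adapted_def)
  have mult: "x (\<mu> l l') * x (\<mu> l' l'') = x (\<mu> l l'')"
    if "l \<in> L" "l' \<in> {l0, l1}" "l'' \<in> {l0, l1}" for l l' l''
  proof -
    have "\<mu> l l' \<in> dual_monoid \<sigma>" "\<mu> l' l'' \<in> dual_monoid \<sigma>"
      using that L l0 l1 by (auto simp: adapted_def)
    then have "x (\<mu> l l' \<otimes>\<^bsub>M\<^esub> \<mu> l' l'') = x (\<mu> l l') * x (\<mu> l' l'')"
      using x by (simp add: chart_points_def)
    then show ?thesis
      using \<mu>_trans[of l l' l''] that L by auto
  qed
  have "x (\<mu> l1 l0) * x (\<mu> l0 l1) = 1"
    using mult[of l1 l0 l1] L x by (simp add: \<mu>_refl chart_points_def)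
  then show "x (\<mu> l1 l0) \<noteq> 0" by auto
  show "coords l0 x l = x (\<mu> l1 l0) * coords l1 x l" if "l \<in> L" for l
    using mult[of l l1 l0] that by (simp add: coords_def mult.commute)
qed

text \<open>
  Two representatives of a glued point come from one point \<open>z\<close> of the chart of the intersection of
  their cones.  Labels adapted to either cone are both adapted to the intersection, so the
  images agree by \<open>coords_change\<close> applied to \<open>z\<close>.
\<close>

lemma proj_map_chart_map:
  assumes \<sigma>: "\<sigma> \<in> Sigma" and x: "x \<in> chart_points \<sigma>" and l0: "adapted \<sigma> l0"
  shows "proj_map (chart_map \<sigma> x) = proj_point L (coords l0 x)"
  unfolding proj_map_def
proof (rule the_elem_image_unique)
  show "chart_map \<sigma> x \<noteq> {}"
    using chart_map_self[OF \<sigma> x] by auto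
  fix q assume "q \<in> chart_map \<sigma> x"
  then obtain \<tau> z where q: "q = (\<tau>, restrict z (dual_monoid \<tau>))" and \<tau>: "\<tau> \<in> Sigma"
    and z: "z \<in> chart_points (\<sigma> \<inter> \<tau>)" "x = restrict z (dual_monoid \<sigma>)"
    by (auto simp: chart_map_def glue_def)
  define l1 where "l1 = (SOME l0. adapted \<tau> l0)"
  have l1: "adapted \<tau> l1"
    unfolding l1_def using adapted_some \<tau> .
  have "proj_point L (coords l1 z) = proj_point L (coords l0 z)"
    using coords_change[OF z(1)] adapted_subset[OF l0] adapted_subset[OF l1] by simp
  moreover have "coords l1 (restrict z (dual_monoid \<tau>)) = coords l1 z" "coords l0 x = coords l0 z"
    using l0 l1 by (auto simp: coords_def adapted_def z(2) intro!: restrict_ext)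
  ultimately show "(\<lambda>(\<sigma>, x). proj_point L (coords (SOME l0. adapted \<sigma> l0) x)) q =
      proj_point L (coords l0 x)"
    by (simp add: q flip: l1_def)
qed

lemma coords_in_proj_points:
  assumes x: "x \<in> chart_points \<sigma>" and l0: "adapted \<sigma> l0"
  shows "proj_point L (coords l0 x) \<in> proj_points L"
proof -
  have "coords l0 x l0 = 1"
    using x l0 by (simp add: coords_def adapted_def \<mu>_refl chart_points_def)
  then show ?thesis
    using l0 unfolding proj_points_def
    by (intro CollectI exI[of _ "coords l0 x"] conjI refl bexI[of _ l0])
      (auto simp: adapted_def coords_def)
qed

lemma coords_pullback:
  assumes "\<sigma> \<in> Sigma" "adapted \<sigma> l0" "F \<in> homogeneous_polys L d"
  shows "\<exists>f\<in>chart_ring \<sigma>. \<forall>x\<in>chart_points \<sigma>. f x = F (coords l0 x)"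
  unfolding coords_def
proof (rule homogeneous_poly_pullback[where \<nu> = "\<lambda>l. \<mu> l l0", OF assms(1) finite_L _ assms(3)])
  show "\<mu> l l0 \<in> dual_monoid \<sigma>" if "l \<in> L" for l
    using assms(2) that by (simp add: adapted_def)
qed

lemma chart_continuous:
  assumes \<sigma>: "\<sigma> \<in> Sigma" and l0: "adapted \<sigma> l0"
  shows "continuous_map (chart_zariski \<sigma>) (proj_zariski L) (\<lambda>x. proj_point L (coords l0 x))"
proof -
  note top = chart_zariski_topspace[OF one_in_dual_monoid[OF \<sigma>]]
  show ?thesis
    unfolding proj_zariski_def
  proof (rule continuous_on_generated_topo)
    show "(\<lambda>x. proj_point L (coords l0 x)) ` topspace (chart_zariski \<sigma>) \<subseteq>
      \<Union> {{P \<in> proj_points L. \<forall>v\<in>P. F v \<noteq> 0} |F. \<exists>d. F \<in> homogeneous_polys L d}"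
      unfolding top proj_zariski_topspace[unfolded proj_zariski_def topology_generated_by_topspace]
      using coords_in_proj_points[OF _ l0] by (rule image_subsetI)
  next
    fix U :: "('l \<Rightarrow> 'k) set set"
    assume "U \<in> {{P \<in> proj_points L. \<forall>v\<in>P. F v \<noteq> 0} |F. \<exists>d. F \<in> homogeneous_polys L d}"
    then obtain F d where U: "U = {P \<in> proj_points L. \<forall>v\<in>P. F v \<noteq> 0}"
      and F: "F \<in> homogeneous_polys L d" by blast
    obtain f where f: "f \<in> chart_ring \<sigma>" "\<forall>x\<in>chart_points \<sigma>. f x = F (coords l0 x)"
      using coords_pullback[OF \<sigma> l0 F] by blast
    have "(\<lambda>x. proj_point L (coords l0 x)) -` U \<inter> topspace (chart_zariski \<sigma>) =
        {x \<in> chart_points \<sigma>. f x \<noteq> 0}"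
      unfolding U top using f(2) coords_in_proj_points[OF _ l0]
      by (auto simp: proj_point_nonzero[OF F])
    then show "openin (chart_zariski \<sigma>)
        ((\<lambda>x. proj_point L (coords l0 x)) -` U \<inter> topspace (chart_zariski \<sigma>))"
      by (simp only: chart_basic_open[OF f(1)])
  qed
qed

lemma chart_pullback_regular:
  assumes \<sigma>: "\<sigma> \<in> Sigma" and l0: "adapted \<sigma> l0"
    and f: "locally_fraction (proj_zariski L) (proj_fractions L) V f"
  shows "chart_regular \<sigma> {x \<in> chart_points \<sigma>. proj_point L (coords l0 x) \<in> V}
    (\<lambda>x. f (proj_point L (coords l0 x)))"
  unfolding chart_regular_def locally_fraction_def
proof
  let ?\<phi> = "\<lambda>x. proj_point L (coords l0 x)"
  fix x assume x: "x \<in> {x \<in> chart_points \<sigma>. ?\<phi> x \<in> V}"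
  then have "?\<phi> x \<in> V" by simp
  from bspec[OF f[unfolded locally_fraction_def] this] obtain W g h where W: "openin (proj_zariski L) W" "?\<phi> x \<in> W" "W \<subseteq> V"
    and gh: "(g, h) \<in> proj_fractions L" "\<forall>y\<in>W. h y \<noteq> 0 \<and> f y = g y / h y"
    by (elim exE conjE)
  from gh(1) obtain F G rep d where g: "g = (\<lambda>P. F (rep P))" and h: "h = (\<lambda>P. G (rep P))"
    and F: "F \<in> homogeneous_polys L d" and G: "G \<in> homogeneous_polys L d"
    and rep: "\<forall>P\<in>proj_points L. rep P \<in> P"
    unfolding proj_fractions_def by (elim CollectE exE conjE Pair_inject)
  obtain F' where F': "F' \<in> chart_ring \<sigma>" "\<forall>x\<in>chart_points \<sigma>. F' x = F (coords l0 x)"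
    using coords_pullback[OF \<sigma> l0 F] by blast
  obtain G' where G': "G' \<in> chart_ring \<sigma>" "\<forall>x\<in>chart_points \<sigma>. G' x = G (coords l0 x)"
    using coords_pullback[OF \<sigma> l0 G] by blast
  let ?W = "{x \<in> chart_points \<sigma>. ?\<phi> x \<in> W}"
  have "openin (chart_zariski \<sigma>) ?W"
    using openin_continuous_map_preimage[OF chart_continuous[OF \<sigma> l0] W(1)]
    by (simp add: chart_zariski_topspace[OF one_in_dual_monoid[OF \<sigma>]])
  moreover have "G' y \<noteq> 0 \<and> f (?\<phi> y) = F' y / G' y" if y: "y \<in> ?W" for y
  proof -
    have "rep (?\<phi> y) \<in> ?\<phi> y"
      using rep coords_in_proj_points[OF _ l0] y by blast
    then obtain c where c: "c \<noteq> 0" "rep (?\<phi> y) = (\<lambda>l\<in>L. c * coords l0 y l)"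
      by (auto simp: proj_point_def)
    \<comment> \<open>Numerator and denominator have the same degree, so the choice of \<open>rep\<close> cancels.\<close>
    have "g (?\<phi> y) = c ^ d * F' y" "h (?\<phi> y) = c ^ d * G' y"
      using y F'(2) G'(2)
      by (simp_all add: g h c(2) homogeneous_poly_scale[OF F] homogeneous_poly_scale[OF G])
    then show ?thesis
      using gh(2) y c(1) by auto
  qed
  ultimately show "\<exists>W g h. openin (chart_zariski \<sigma>) W \<and> x \<in> W \<and>
      W \<subseteq> {x \<in> chart_points \<sigma>. ?\<phi> x \<in> V} \<and> (g, h) \<in> chart_ring \<sigma> \<times> chart_ring \<sigma> \<and>
      (\<forall>y\<in>W. h y \<noteq> 0 \<and> f (?\<phi> y) = g y / h y)"
    using F'(1) G'(1) W(2,3) x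
    by (intro exI[of _ ?W] exI[of _ F'] exI[of _ G']) auto
qed

lemma glued_topspace: "topspace glued_zariski = points"
proof -
  have "openin glued_zariski points"
    unfolding openin_glued_zariski
  proof (intro conjI ballI)
    fix \<sigma> assume \<sigma>: "\<sigma> \<in> Sigma"
    then have "{x \<in> chart_points \<sigma>. chart_map \<sigma> x \<in> points} = topspace (chart_zariski \<sigma>)"
      using chart_map_in_points by (auto simp: chart_zariski_topspace one_in_dual_monoid)
    then show "openin (chart_zariski \<sigma>) {x \<in> chart_points \<sigma>. chart_map \<sigma> x \<in> points}"
      by simp
  qed simp
  then show ?thesis
    using openin_glued_zariski by (metis openin_subset openin_topspace subset_antisym)
qed

lemma proj_map_morphism:
  "variety_morphism toric_variety_of_fan (projective_space L) proj_map"
proof -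
  have preimage: "{x \<in> chart_points \<sigma>. chart_map \<sigma> x \<in> {C \<in> points. proj_map C \<in> V}} =
      {x \<in> chart_points \<sigma>. proj_point L (coords l0 x) \<in> V}"
    if "\<sigma> \<in> Sigma" "adapted \<sigma> l0" for \<sigma> l0 V
    using that chart_map_in_points by (auto simp: proj_map_chart_map)
  have "continuous_map glued_zariski (proj_zariski L) proj_map"
    unfolding continuous_map_def
  proof (intro conjI allI impI)
    show "proj_map \<in> topspace glued_zariski \<rightarrow> topspace (proj_zariski L)"
      unfolding glued_topspace proj_zariski_topspace
    proof
      fix C assume "C \<in> points"
      then obtain \<sigma> x where \<sigma>: "\<sigma> \<in> Sigma" "x \<in> chart_points \<sigma>" "C = chart_map \<sigma> x"
        by (rule in_pointsE)
      then obtain l0 where "adapted \<sigma> l0" using adapted_exists by blast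
      then show "proj_map C \<in> proj_points L"
        using \<sigma> by (simp add: proj_map_chart_map coords_in_proj_points)
    qed
  next
    fix V :: "('l \<Rightarrow> 'k) set set" assume V: "openin (proj_zariski L) V"
    show "openin glued_zariski {C \<in> topspace glued_zariski. proj_map C \<in> V}"
      unfolding openin_glued_zariski glued_topspace
    proof (intro conjI ballI)
      fix \<sigma> assume \<sigma>: "\<sigma> \<in> Sigma"
      then obtain l0 where l0: "adapted \<sigma> l0" using adapted_exists by blast
      show "openin (chart_zariski \<sigma>) {x \<in> chart_points \<sigma>. chart_map \<sigma> x \<in> {C \<in> points. proj_map C \<in> V}}"
        using openin_continuous_map_preimage[OF chart_continuous[OF \<sigma> l0] V]
        by (simp only: preimage[OF \<sigma> l0] chart_zariski_topspace[OF one_in_dual_monoid[OF \<sigma>]])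
    qed auto
  qed
  moreover have "glued_regular {C \<in> points. proj_map C \<in> V} (f \<circ> proj_map)"
    if f: "locally_fraction (proj_zariski L) (proj_fractions L) V f" for V f
    unfolding glued_regular_def
  proof
    fix \<sigma> assume \<sigma>: "\<sigma> \<in> Sigma"
    then obtain l0 where l0: "adapted \<sigma> l0" using adapted_exists by blast
    show "chart_regular \<sigma> {x \<in> chart_points \<sigma>. chart_map \<sigma> x \<in> {C \<in> points. proj_map C \<in> V}}
        (f \<circ> proj_map \<circ> chart_map \<sigma>)"
      unfolding preimage[OF \<sigma> l0] chart_regular_def
      using chart_pullback_regular[OF \<sigma> l0 f, unfolded chart_regular_def]
      by (rule locally_fraction_cong) (simp add: proj_map_chart_map[OF \<sigma> _ l0])
  qed
  ultimately show ?thesis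
    by (simp add: variety_morphism_def toric_variety_of_fan_def projective_space_def glued_topspace)
qed

end

section \<open>The ratio map on the fan of trees\<close>

text \<open>
  This is the exponent vector of \<open>(p_jl / p_il) / (p_jl' / p_il')\<close>, the pullback along the ratio map
  of the quotient of the homogeneous coordinates with indices \<open>l\<close> and \<open>l'\<close>.
\<close>

definition ratio_character :: "'a set \<Rightarrow> 'a \<Rightarrow> 'a \<Rightarrow> 'a \<Rightarrow> 'a \<Rightarrow> 'a set \<Rightarrow> int" where
  "ratio_character S i j l l' = (\<lambda>e\<in>pairs S.
     of_bool (e = {j, l}) - of_bool (e = {i, l}) - of_bool (e = {j, l'}) + of_bool (e = {i, l'}))"

lemma monomial_ratio_character:
  assumes "finite S" "i \<in> S" "j \<in> S" "l \<in> S - {i, j}" "l' \<in> S - {i, j}"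
    and t: "t \<in> carrier (torus_power (pairs S))"
  shows "monomial (pairs S) (ratio_character S i j l l') t =
    (t {j, l} / t {i, l}) / (t {j, l'} / t {i, l'})"
proof -
  have fin: "finite (pairs S)" using assms(1) by (simp add: finite_imp_finite_nsets)
  have single: "(\<Prod>e\<in>pairs S. t e powi of_bool (e = e0)) = t e0" if "e0 \<in> pairs S" for e0
  proof -
    have "(\<Prod>e\<in>pairs S. t e powi of_bool (e = e0)) = (\<Prod>e\<in>pairs S. if e = e0 then t e else 1)"
      by (intro prod.cong) auto
    then show ?thesis using fin that by simp
  qed
  have "monomial (pairs S) (ratio_character S i j l l') t =
      (\<Prod>e\<in>pairs S. t e powi of_bool (e = {j, l}) / t e powi of_bool (e = {i, l}) /
         t e powi of_bool (e = {j, l'}) * t e powi of_bool (e = {i, l'}))"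
    unfolding monomial_def ratio_character_def using t unfolding torus_power_carrier
    by (intro prod.cong) (simp_all add: power_int_add power_int_diff)
  also have "\<dots> = t {j, l} / t {i, l} / t {j, l'} * t {i, l'}"
    unfolding prod.distrib prod_dividef using assms(2-5) by (subst (1 2 3 4) single) auto
  finally show ?thesis by simp
qed

lemma ratio_character_lattice:
  assumes "finite S" "i \<in> S" "j \<in> S" "l \<in> S - {i, j}" "l' \<in> S - {i, j}"
  shows "ratio_character S i j l l' \<in>
    carrier (character_lattice (pairs S) (mult_image S :: ('a set \<Rightarrow> 'k::field) set))"
  unfolding in_character_lattice
proof (intro conjI ballI)
  show "ratio_character S i j l l' \<in> extensional (pairs S)"
    by (simp add: ratio_character_def)
  fix t :: "'a set \<Rightarrow> 'k" assume t: "t \<in> mult_image S"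
  interpret H: normal "mult_image S :: ('a set \<Rightarrow> 'k) set" "torus_power (pairs S)"
    by (rule mult_image_normal)
  have tc: "t \<in> carrier (torus_power (pairs S))"
    using H.subset t by blast
  obtain s where s: "s \<in> carrier (torus_power S)" "t = (\<lambda>e\<in>pairs S. \<Prod>a\<in>e. s a)"
    using t unfolding mult_image_def by blast
  have "t {a, b} = s a * s b" if "a \<in> S" "b \<in> S" "a \<noteq> b" for a b
    using that by (simp add: s(2))
  moreover have "s a \<noteq> 0" if "a \<in> S" for a
    using s(1) that unfolding torus_power_carrier by blast
  ultimately show "monomial (pairs S) (ratio_character S i j l l') t = 1"
    using assms(2-5) unfolding monomial_ratio_character[OF assms tc] by (auto simp: field_simps)
qed

lemma sum_ratio_character:
  fixes w :: "'a set \<Rightarrow> real"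
  assumes "finite S" "i \<in> S" "j \<in> S" "l \<in> S - {i, j}" "l' \<in> S - {i, j}"
  shows "(\<Sum>e\<in>pairs S. of_int (ratio_character S i j l l' e) * w e) =
    (w {j, l} - w {i, l}) - (w {j, l'} - w {i, l'})"
proof -
  have fin: "finite (pairs S)" using assms(1) by (simp add: finite_imp_finite_nsets)
  have single: "(\<Sum>e\<in>pairs S. of_bool (e = e0) * w e) = w e0" if "e0 \<in> pairs S" for e0
  proof -
    have "(\<Sum>e\<in>pairs S. of_bool (e = e0) * w e) = (\<Sum>e\<in>pairs S. if e = e0 then w e else 0)"
      by (intro sum.cong) auto
    then show ?thesis using fin that by simp
  qed
  have "(\<Sum>e\<in>pairs S. of_int (ratio_character S i j l l' e) * w e) =
      (\<Sum>e\<in>pairs S. of_bool (e = {j, l}) * w e - of_bool (e = {i, l}) * w e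
         - of_bool (e = {j, l'}) * w e + of_bool (e = {i, l'}) * w e)"
    unfolding ratio_character_def by (intro sum.cong) (simp_all add: algebra_simps)
  also have "\<dots> = w {j, l} - w {i, l} - w {j, l'} + w {i, l'}"
    unfolding sum.distrib sum_subtractf using assms(2-5) by (subst (1 2 3 4) single) auto
  finally show ?thesis by simp
qed

text \<open>
  On the cone of a tree the character \<open>ratio_character S i j l l0\<close> pairs with a metric to half of
  \<open>(d_jl0 - d_il0) - (d_jl - d_il)\<close>, because the embedding carries the factor \<open>- 1/2\<close>.  It is
  therefore nonnegative for a label \<open>l0\<close> at which \<open>d_jl - d_il\<close> is maximal.
\<close>

lemma tree_cone_to_projective_cone:
  assumes S: "finite S" and card: "3 \<le> card S" and ij: "i \<in> S" "j \<in> S" "i \<noteq> j"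
    and tree: "stable_tree S \<tau>"
  shows "\<exists>l0\<in>S - {i, j}. \<forall>l\<in>S - {i, j}. \<forall>u\<in>tree_cone S \<tau>.
    0 \<le> pairing (pairs S) (ratio_character S i j l l0) u"
proof -
  have "card (S - {i, j}) = card S - 2"
    using ij S by (simp add: card_Diff_subset)
  then have "card (S - {i, j}) \<noteq> 0" using card by linarith
  then have "S - {i, j} \<noteq> {}" by (metis card.empty)
  moreover have "leg \<tau> i \<in> verts \<tau>" "leg \<tau> j \<in> verts \<tau>" "leg \<tau> ` (S - {i, j}) \<subseteq> verts \<tau>"
    using tree ij by (auto simp: stable_tree_def)
  ultimately obtain l0 where l0: "l0 \<in> S - {i, j}" "\<And>l len. \<lbrakk>l \<in> S - {i, j}; \<forall>e\<in>edges \<tau>. 0 \<le> len e\<rbrakk> \<Longrightarrow>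
      tree_dist \<tau> len (leg \<tau> j) (leg \<tau> l) - tree_dist \<tau> len (leg \<tau> i) (leg \<tau> l) \<le>
      tree_dist \<tau> len (leg \<tau> j) (leg \<tau> l0) - tree_dist \<tau> len (leg \<tau> i) (leg \<tau> l0)"
    using uniform_maximum_tree_dist_diff[OF tree, of "leg \<tau> i" "leg \<tau> j" "S - {i, j}" "leg \<tau>"]
      finite_Diff[OF S] by blast
  have "0 \<le> pairing (pairs S) (ratio_character S i j l l0) u"
    if l: "l \<in> S - {i, j}" and u: "u \<in> tree_cone S \<tau>" for l u
  proof -
    obtain w len where u_eq: "u = add_image S #>\<^bsub>real_power (pairs S)\<^esub> w"
      and len: "\<forall>e\<in>edges \<tau>. 0 \<le> len e" and w: "w \<in> carrier (real_power (pairs S))"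
      and dist: "\<forall>a\<in>S. \<forall>b\<in>S. a \<noteq> b \<longrightarrow> w {a, b} = - (1 / 2) * tree_dist \<tau> len (leg \<tau> a) (leg \<tau> b)"
      using u unfolding tree_cone_def by (elim CollectE exE conjE)
    \<comment> \<open>The pairing does not mention the ground field, so the membership in the character lattice
      that makes it well defined may be checked over the reals.\<close>
    have "pairing (pairs S) (ratio_character S i j l l0) u =
        (w {j, l} - w {i, l}) - (w {j, l0} - w {i, l0})"
      unfolding u_eq pairing_coset[where 'k = real, OF S ratio_character_lattice[OF S ij(1,2) l l0(1)] w]
      by (rule sum_ratio_character[OF S ij(1,2) l l0(1)])
    moreover have "w {j, l} = - (1 / 2) * tree_dist \<tau> len (leg \<tau> j) (leg \<tau> l)"
        "w {i, l} = - (1 / 2) * tree_dist \<tau> len (leg \<tau> i) (leg \<tau> l)"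
        "w {j, l0} = - (1 / 2) * tree_dist \<tau> len (leg \<tau> j) (leg \<tau> l0)"
        "w {i, l0} = - (1 / 2) * tree_dist \<tau> len (leg \<tau> i) (leg \<tau> l0)"
      using dist ij l l0(1) by (auto simp del: of_nat_numeral)
    ultimately show ?thesis
      using l0(2)[OF l len] by (simp add: field_simps)
  qed
  then show ?thesis using l0(1) by blast
qed

text \<open>
  The zero cone belongs to the tree with a single vertex, which is stable because at
  least three legs are attached to it.
\<close>

lemma zero_cone_in_tree_fan:
  assumes card: "3 \<le> card S"
  shows "{add_image S} \<in> tree_fan S"
proof -
  let ?\<tau> = "\<lparr>verts = {0}, edges = {}, leg = \<lambda>_. 0\<rparr> :: (nat, 'a) marked_tree"
  have path: "simple_path ?\<tau> 0 0 vs \<longleftrightarrow> vs = [0]" for vs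
  proof
    assume "simple_path ?\<tau> 0 0 vs"
    then have "vs \<noteq> []" "distinct vs" "set vs \<subseteq> {0}" by (auto simp: simple_path_def)
    then show "vs = [0]" by (cases vs; cases "tl vs") auto
  qed (simp add: simple_path_def)
  have stable: "stable_tree S ?\<tau>"
    using card by (auto simp: stable_tree_def path)
  have dist: "tree_dist ?\<tau> len 0 0 = 0" for len
    by (simp add: tree_dist_def path)
  let ?N = "real_power (pairs S)"
  interpret add: normal "add_image S" ?N by (rule add_image_normal)
  have zero: "add_image S #>\<^bsub>?N\<^esub> (\<lambda>e\<in>pairs S. 0) = add_image S"
    using add.coset_mult_one[OF add.subset] by (simp add: real_group_def)
  have "tree_cone S ?\<tau> = {add_image S}"
  proof (intro equalityI subsetI)
    fix u assume "u \<in> tree_cone S ?\<tau>"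
    then obtain w where u: "u = add_image S #>\<^bsub>?N\<^esub> w" and w: "w \<in> carrier ?N"
      and "\<forall>a\<in>S. \<forall>b\<in>S. a \<noteq> b \<longrightarrow> w {a, b} = 0"
      unfolding tree_cone_def by (auto simp: dist simp del: carrier_product_group)
    moreover from this have "w = (\<lambda>e\<in>pairs S. 0)"
      unfolding real_power_carrier
      by (intro extensionalityI[where A = "pairs S"]) (auto elim!: nsets2_E)
    ultimately show "u \<in> {add_image S}" by (simp add: zero)
  next
    fix u assume "u \<in> {add_image S}"
    then have "u = add_image S #>\<^bsub>?N\<^esub> (\<lambda>e\<in>pairs S. 0)" using zero by simp
    moreover have "(\<lambda>e\<in>pairs S. 0) \<in> carrier ?N" by (simp add: real_power_carrier del: carrier_product_group)
    ultimately show "u \<in> tree_cone S ?\<tau>"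
      unfolding tree_cone_def
      by (intro CollectI exI[of _ "\<lambda>e\<in>pairs S. 0"] exI[of _ "\<lambda>_. 0"]) (simp add: dist)
  qed
  then show ?thesis using stable unfolding tree_fan_def by blast
qed

lemma tree_fan_element:
  assumes "\<sigma> \<in> tree_fan S" "u \<in> \<sigma>"
  obtains w where "w \<in> carrier (real_power (pairs S))" "u = add_image S #>\<^bsub>real_power (pairs S)\<^esub> w"
  using assms unfolding tree_fan_def tree_cone_def by blast

lemma ratio_hom:
  assumes "i \<in> S" "j \<in> S"
  shows "(\<lambda>p. \<lambda>l\<in>S - {i, j}. p {j, l} / p {i, l}) \<in>
    hom (torus_power (pairs S)) (torus_power (S - {i, j}) :: ('a \<Rightarrow> 'k::field) monoid)"
proof (rule homI)
  fix p q :: "'a set \<Rightarrow> 'k"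
  assume "p \<in> carrier (torus_power (pairs S))"
  then show "(\<lambda>l\<in>S - {i, j}. p {j, l} / p {i, l}) \<in> carrier (torus_power (S - {i, j}))"
    using assms unfolding torus_power_carrier by auto
  show "(\<lambda>l\<in>S - {i, j}. (p \<otimes>\<^bsub>torus_power (pairs S)\<^esub> q) {j, l} / (p \<otimes>\<^bsub>torus_power (pairs S)\<^esub> q) {i, l}) =
      (\<lambda>l\<in>S - {i, j}. p {j, l} / p {i, l}) \<otimes>\<^bsub>torus_power (S - {i, j})\<^esub> (\<lambda>l\<in>S - {i, j}. q {j, l} / q {i, l})"
    unfolding torus_power_mult using assms by (intro restrict_ext) auto
qed

text \<open>
  A vector \<open>s\<close> rescales every ratio \<open>p_jl / p_il\<close> by the same factor \<open>s j / s i\<close>; so the ratio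
  map descends to the quotient tori.
\<close>

lemma ratio_mult_image:
  assumes "i \<in> S" "j \<in> S"
  shows "(\<lambda>p. \<lambda>l\<in>S - {i, j}. p {j, l} / p {i, l}) ` (mult_image S :: ('a set \<Rightarrow> 'k::field) set)
    \<subseteq> diagonal (S - {i, j})"
proof (rule image_subsetI)
  fix p :: "'a set \<Rightarrow> 'k" assume "p \<in> mult_image S"
  then obtain s where s: "s \<in> carrier (torus_power S)" "p = (\<lambda>e\<in>pairs S. \<Prod>a\<in>e. s a)"
    unfolding mult_image_def by blast
  then have nz: "s a \<noteq> 0" if "a \<in> S" for a
    using that unfolding torus_power_carrier by blast
  have "(\<lambda>l\<in>S - {i, j}. p {j, l} / p {i, l}) = (\<lambda>l\<in>S - {i, j}. s j / s i)"
    using assms nz by (intro restrict_ext) (auto simp: s(2))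
  then show "(\<lambda>l\<in>S - {i, j}. p {j, l} / p {i, l}) \<in> diagonal (S - {i, j})"
    unfolding diagonal_def using nz assms by (intro CollectI exI[of _ "s j / s i"]) simp
qed

lemma ratio_map_hom:
  assumes "i \<in> S" "j \<in> S"
  shows "ratio_map S i j \<in> hom (pair_torus S)
      (torus_power (S - {i, j}) Mod (diagonal (S - {i, j}) :: ('a \<Rightarrow> 'k::field) set))"
  unfolding ratio_map_def [abs_def] pair_torus_def
  by (rule group_hom_between_quotients(2)[OF mult_image_normal diagonal_normal
      ratio_hom[OF assms] ratio_mult_image[OF assms]])

lemma ratio_map_coset:
  assumes "i \<in> S" "j \<in> S" "p \<in> carrier (torus_power (pairs S) :: ('a set \<Rightarrow> 'k::field) monoid)"
  shows "ratio_map S i j (mult_image S #>\<^bsub>torus_power (pairs S)\<^esub> p) =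
    diagonal (S - {i, j}) #>\<^bsub>torus_power (S - {i, j})\<^esub> (\<lambda>l\<in>S - {i, j}. p {j, l} / p {i, l})"
  unfolding ratio_map_def
  by (rule group_hom_between_quotients(1)[OF mult_image_normal diagonal_normal
      ratio_hom[OF assms(1,2)] ratio_mult_image[OF assms(1,2)] assms(3)])

lemma projective_space_embed_coset:
  assumes v: "v \<in> carrier (torus_power L)"
  shows "embed (projective_space L) (diagonal L #>\<^bsub>torus_power L\<^esub> v) = proj_point L v"
  unfolding projective_space_def toric_variety.simps
proof (rule the_elem_image_unique)
  interpret D: normal "diagonal L" "torus_power L :: ('a \<Rightarrow> 'b) monoid" by (rule diagonal_normal)
  show "diagonal L #>\<^bsub>torus_power L\<^esub> v \<noteq> {}"
    using D.rcos_self[OF v D.is_subgroup] by blast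
  fix w assume "w \<in> diagonal L #>\<^bsub>torus_power L\<^esub> v"
  then obtain c where "c \<noteq> 0" "w = (\<lambda>l\<in>L. c) \<otimes>\<^bsub>torus_power L\<^esub> v"
    unfolding r_coset_def diagonal_def by blast
  then show "proj_point L w = proj_point L v"
    unfolding torus_power_mult by (intro proj_point_scale[of c]) auto
qed

theorem proposition6p2:
  fixes S :: "'a set" and i j :: 'a
    and Y :: "((('a set \<Rightarrow> real) set set \<times>
                 (('a set \<Rightarrow> int) \<Rightarrow> 'k::{alg_closed_field, field_char_0})) set, 'k,
               ('a set \<Rightarrow> 'k) set) toric_variety"
    and P :: "(('a \<Rightarrow> 'k) set, 'k, ('a \<Rightarrow> 'k) set) toric_variety"
  assumes "finite S" and "3 \<le> card S" and "i \<in> S" and "j \<in> S" and "i \<noteq> j"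
    and "Y = tree_fan_variety S" and "P = projective_space (S - {i, j})"
  shows "ratio_map S i j \<in> hom (torus Y) (torus P) \<and>
    (\<exists>\<Phi>. toric_morphism Y P \<Phi> \<and>
       (\<forall>t \<in> carrier (torus Y). \<Phi> (embed Y t) = embed P (ratio_map S i j t)))"
proof -
  let ?G = "torus_power (pairs S) :: ('a set \<Rightarrow> 'k) monoid"
  let ?H = "mult_image S :: ('a set \<Rightarrow> 'k) set"
  let ?L = "S - {i, j}"
  interpret H: normal ?H ?G by (rule mult_image_normal)
  interpret fan_to_projective "character_lattice (pairs S) ?H" "real_power (pairs S) Mod add_image S"
    "pairing (pairs S)" "pair_torus S :: ('a set \<Rightarrow> 'k) set monoid" "character (pairs S)" "tree_fan S"
    ?L "ratio_character S i j"
  proof (intro fan_to_projective.intro additive_fan.intro fan_to_projective_axioms.intro)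
    show "finite ?L" using \<open>finite S\<close> by simp
  next
    show "comm_monoid (character_lattice (pairs S) ?H)"
      by (rule comm_monoid_character_lattice[OF H.subset])
  next
    fix \<sigma> u m m'
    assume \<sigma>: "\<sigma> \<in> tree_fan S" "u \<in> \<sigma>"
      and m: "m \<in> carrier (character_lattice (pairs S) ?H)" "m' \<in> carrier (character_lattice (pairs S) ?H)"
    have mm: "m \<otimes>\<^bsub>character_lattice (pairs S) ?H\<^esub> m' \<in> carrier (character_lattice (pairs S) ?H)"
      using comm_monoid_character_lattice[OF H.subset] m
      by (auto simp only: comm_monoid_def intro: monoid.m_closed)
    from \<sigma> obtain w where w: "w \<in> carrier (real_power (pairs S))"
        "u = add_image S #>\<^bsub>real_power (pairs S)\<^esub> w"
      by (rule tree_fan_element)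
    show "pairing (pairs S) (m \<otimes>\<^bsub>character_lattice (pairs S) ?H\<^esub> m') u =
        pairing (pairs S) m u + pairing (pairs S) m' u"
      unfolding w(2) pairing_coset[OF \<open>finite S\<close> m(1) w(1)] pairing_coset[OF \<open>finite S\<close> m(2) w(1)]
        pairing_coset[OF \<open>finite S\<close> mm w(1)]
      by (simp add: distrib_right sum.distrib)
  next
    show "ratio_character S i j l l = \<one>\<^bsub>character_lattice (pairs S) ?H\<^esub>" for l
      by (auto simp: ratio_character_def intro!: restrict_ext)
  next
    show "ratio_character S i j l l' \<otimes>\<^bsub>character_lattice (pairs S) ?H\<^esub> ratio_character S i j l' l'' =
        ratio_character S i j l l''" for l l' l''
      by (auto simp: ratio_character_def intro!: restrict_ext)
  next
    fix \<sigma> assume "\<sigma> \<in> tree_fan S"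
    then obtain \<tau> :: "(nat, 'a) marked_tree" where \<tau>: "stable_tree S \<tau>" "\<sigma> = tree_cone S \<tau>"
      unfolding tree_fan_def by blast
    obtain l0 where "l0 \<in> ?L" "\<forall>l\<in>?L. \<forall>u\<in>\<sigma>. 0 \<le> pairing (pairs S) (ratio_character S i j l l0) u"
      using tree_cone_to_projective_cone[OF assms(1-5) \<tau>(1)] \<tau>(2) by blast
    then show "\<exists>l0\<in>?L. \<forall>l\<in>?L. ratio_character S i j l l0 \<in>
        fan_data.dual_monoid (character_lattice (pairs S) ?H) (pairing (pairs S)) \<sigma>"
      using ratio_character_lattice[OF assms(1,3,4)]
      unfolding fan_data.dual_monoid_def by (intro bexI[of _ l0]) auto
  qed
  have Y: "Y = toric_variety_of_fan"
    using assms(6) by (simp add: tree_fan_variety_def)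
  have torus: "torus Y = pair_torus S"
    by (simp add: Y toric_variety_of_fan_def)
  have zero: "\<one>\<^bsub>real_power (pairs S) Mod add_image S\<^esub> = add_image S" by simp
  have zero_cone: "{add_image S} \<in> tree_fan S"
    using zero_cone_in_tree_fan[OF assms(2)] .
  then obtain l0 where l0: "adapted {add_image S} l0" using adapted_exists by blast
  then have l0_L: "l0 \<in> ?L" by (simp add: adapted_def)
  have compatible: "proj_map (embed Y t) = embed P (ratio_map S i j t)"
    if t_torus: "t \<in> carrier (torus Y)" for t
  proof -
    obtain p where t: "t = ?H #>\<^bsub>?G\<^esub> p" and p: "p \<in> carrier ?G"
      using t_torus unfolding torus pair_torus_def carrier_FactGroup by (elim imageE)
    note char = character_coset[OF mult_image_normal _ p, folded t]
    let ?D = "dual_monoid {add_image S}"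
    let ?x = "\<lambda>m\<in>?D. character (pairs S) m t"
    have D: "m \<in> carrier (character_lattice (pairs S) ?H)" if "m \<in> ?D" for m
      using that by (simp add: dual_monoid_def)
    have "?x \<in> chart_points {add_image S}"
      unfolding chart_points_def
      using one_in_dual_monoid[OF zero_cone] mult_in_dual_monoid[OF zero_cone] D
      by (auto simp: char monomial_zero monomial_add[OF p])
    \<comment> \<open>The torus sits in the variety as the chart of the zero cone.\<close>
    then have "proj_map (embed Y t) = proj_point ?L (coords l0 ?x)"
      using proj_map_chart_map[OF zero_cone _ l0]
      by (simp add: Y toric_variety_of_fan_def)
    also have "\<dots> = proj_point ?L (\<lambda>l\<in>?L. p {j, l} / p {i, l})"
    proof (rule proj_point_scale)
      \<comment> \<open>The chart coordinates are the ratios divided by the ratio with index \<open>l0\<close>.\<close>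
      have "p {j, l0} \<noteq> 0" "p {i, l0} \<noteq> 0"
        using p l0_L assms(3,4) unfolding torus_power_carrier by auto
      then show "inverse (p {j, l0} / p {i, l0}) \<noteq> 0" by simp
      fix l assume l: "l \<in> ?L"
      then have "coords l0 ?x l = monomial (pairs S) (ratio_character S i j l l0) p"
        using l0 D by (auto simp: coords_def adapted_def char)
      then show "coords l0 ?x l = inverse (p {j, l0} / p {i, l0}) * (\<lambda>l\<in>?L. p {j, l} / p {i, l}) l"
        using l monomial_ratio_character[OF assms(1,3,4) l l0_L p] by (simp add: field_simps)
    qed
    also have "\<dots> = embed P (ratio_map S i j t)"
      using hom_in_carrier[OF ratio_hom[OF assms(3,4)] p]
      by (simp only: t assms(7) ratio_map_coset[OF assms(3,4) p] projective_space_embed_coset)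
    finally show ?thesis .
  qed
  have hom: "ratio_map S i j \<in> hom (torus Y) (torus P)"
    using ratio_map_hom[OF assms(3,4)] by (simp add: torus assms(7) projective_space_def)
  have "toric_morphism Y P proj_map"
    unfolding toric_morphism_def
  proof
    show "variety_morphism Y P proj_map"
      unfolding Y assms(7) by (rule proj_map_morphism)
    show "\<exists>\<psi>\<in>hom (torus Y) (torus P). \<forall>t\<in>carrier (torus Y). proj_map (embed Y t) = embed P (\<psi> t)"
      using hom compatible by blast
  qed
  then show ?thesis using hom compatible by blast
qed

end
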